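(* Let $X=(X_t)_{t\ge0}$ be a continuous positive strict local $\mathbb{P}$-martingale. Let $a=(a_n)_{n\in\mathbb{N}}$ and $b=(b_n)_{n\in\mathbb{N}}$ be increasing sequences of positive real numbers converging to $\infty$. Define the sequence of stopping times $(\tau^{a,b}_n)_{n\in\mathbb{N}_0}$ by $\tau^{a,b}_0:=0$ and $$\tau^{a,b}_n:=\inf\{t\ge0: X_t\ge b_n\}\wedge a_n,\quad n\in\mathbb{N},$$ and set $S^{a,b}_n:=X_{\tau^{a,b}_n}$ for $n\in\mathbb{N}_0$. Then the measure $\mathbb{P}$ is a bubble measure for the discrete-time martingale $S^{a,b}=(S^{a,b}_n)_{n\in\mathbb{N}_0}$.
   Context: A strict local $\mathbb{P}$-martingale is a local $\mathbb{P}$-martingale that is not a $\mathbb{P}$-martingale; here a local martingale is an adapted process $X$ for which there are stopping times $\sigma_n\uparrow\infty$ a.s. such that each stopped process $X^{\sigma_n}$ is a martingale (in particular $X_0$ is integrable). $S^{a,b}$ is a martingale for the filtration $(\mathcal{F}_{\tau^{a,b}_n})_{n\in\mathbb{N}_0}$. Definition (bubble): a nonnegative discrete-time martingale $S=(S_k)_{k\in\mathbb{N}_0}$ converges $\mathbb{P}$-a.s. to some integrable $S_\infty$. Put $\tau_0:=0$ and $\tau_k:=\inf\{j>\tau_{k-1}: S_j<S_{j-1}\}$ for $k\in\mathbb{N}$ ($\inf\emptyset=\infty$), and $S_{\tau_k}:=S_\infty$ on $\{\tau_k=\infty\}$. $S$ is a bubble, and $\mathbb{P}$ is a bubble measure for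 $S$, if $\mathbb{E}[S_{\tau_k}]<\mathbb{E}[S_0]$ for some $k\in\mathbb{N}$. *)

theory Defs
  imports "HOL-Probability.Probability"
begin

text \<open>
  Continuous time \<open>[0,\<infinity>)\<close> is the part \<open>{0..}\<close> of the type \<^typ>\<open>real\<close>. A filtration indexed by all
  of \<^typ>\<open>real\<close> is the same as one indexed by \<open>[0,\<infinity>)\<close> for the present purposes: any filtration on
  \<open>[0,\<infinity>)\<close> extends by \<open>F t = F 0\<close> for \<open>t < 0\<close>, and for random times with values in \<open>[0,\<infinity>)\<close>
  negative indices contribute only the empty set to \<^const>\<open>stopping_time\<close> and
  \<^const>\<open>filtration.pre_sigma\<close>. No usual conditions are imposed.
\<close>

definition martingale ::
  "'a measure \<Rightarrow> 't set \<Rightarrow> ('t::{linorder_topology, second_countable_topology} \<Rightarrow> 'a measure)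
    \<Rightarrow> ('t \<Rightarrow> 'a \<Rightarrow> real) \<Rightarrow> bool"
where
  "martingale M I F X \<longleftrightarrow>
     filtration (space M) F \<and> (\<forall>t. subalgebra M (F t)) \<and>
     (\<forall>t\<in>I. X t \<in> borel_measurable (F t)) \<and>
     (\<forall>t\<in>I. integrable M (X t)) \<and>
     (\<forall>s\<in>I. \<forall>t\<in>I. s \<le> t \<longrightarrow> (AE \<omega> in M. real_cond_exp M (F s) (X t) \<omega> = X s \<omega>))"

text \<open>The library notion \<^const>\<open>stopping_time\<close> identifies the type of the random time with the index
  type of the filtration; localizing sequences need the value \<open>\<infinity>\<close> as well.\<close>

definition ext_stopping_time :: "(real \<Rightarrow> 'a measure) \<Rightarrow> ('a \<Rightarrow> ennreal) \<Rightarrow> bool" where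
  "ext_stopping_time F \<sigma> \<longleftrightarrow> (\<forall>t\<ge>0. Measurable.pred (F t) (\<lambda>\<omega>. \<sigma> \<omega> \<le> ennreal t))"

definition stopped_process ::
  "(real \<Rightarrow> 'a \<Rightarrow> real) \<Rightarrow> ('a \<Rightarrow> ennreal) \<Rightarrow> real \<Rightarrow> 'a \<Rightarrow> real"
where
  "stopped_process X \<sigma> t \<omega> = X (enn2real (min (ennreal t) (\<sigma> \<omega>))) \<omega>"

definition local_martingale ::
  "'a measure \<Rightarrow> (real \<Rightarrow> 'a measure) \<Rightarrow> (real \<Rightarrow> 'a \<Rightarrow> real) \<Rightarrow> bool"
where
  "local_martingale M F X \<longleftrightarrow>
     (\<forall>t\<ge>0. X t \<in> borel_measurable (F t)) \<and>
     (\<exists>\<sigma> :: nat \<Rightarrow> 'a \<Rightarrow> ennreal.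
        (\<forall>n. ext_stopping_time F (\<sigma> n)) \<and>
        (AE \<omega> in M. incseq (\<lambda>n. \<sigma> n \<omega>) \<and> (\<lambda>n. \<sigma> n \<omega>) \<longlonglongrightarrow> \<infinity>) \<and>
        (\<forall>n. martingale M {0..} F (stopped_process X (\<sigma> n))))"

definition strict_local_martingale ::
  "'a measure \<Rightarrow> (real \<Rightarrow> 'a measure) \<Rightarrow> (real \<Rightarrow> 'a \<Rightarrow> real) \<Rightarrow> bool"
where
  "strict_local_martingale M F X \<longleftrightarrow> local_martingale M F X \<and> \<not> martingale M {0..} F X"

text \<open>In \<^typ>\<open>enat\<close> and \<^typ>\<open>ennreal\<close> the infimum of the empty set is \<open>\<infinity>\<close>.\<close>

fun drop_time :: "(nat \<Rightarrow> 'a \<Rightarrow> real) \<Rightarrow> nat \<Rightarrow> 'a \<Rightarrow> enat" where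
  "drop_time S 0 \<omega> = 0"
| "drop_time S (Suc k) \<omega> = Inf {enat j | j. drop_time S k \<omega> < enat j \<and> S j \<omega> < S (j - 1) \<omega>}"

text \<open>A nonnegative martingale converges almost surely to an integrable limit, so
  \<^term>\<open>\<lambda>\<omega>. lim (\<lambda>n. S n \<omega>)\<close> is a version of \<open>S\<^sub>\<infinity>\<close>; on the exceptional null set it has an
  unspecified value. By Fatou's lemma the random variable below is then integrable for
  \<open>T = drop_time S k\<close>, so its Bochner integral is the genuine expectation.\<close>

definition sampled_value :: "(nat \<Rightarrow> 'a \<Rightarrow> real) \<Rightarrow> ('a \<Rightarrow> enat) \<Rightarrow> 'a \<Rightarrow> real" where
  "sampled_value S T \<omega> = (case T \<omega> of enat n \<Rightarrow> S n \<omega> | \<infinity> \<Rightarrow> lim (\<lambda>n. S n \<omega>))"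

definition bubble_measure ::
  "'a measure \<Rightarrow> (nat \<Rightarrow> 'a measure) \<Rightarrow> (nat \<Rightarrow> 'a \<Rightarrow> real) \<Rightarrow> bool"
where
  "bubble_measure M G S \<longleftrightarrow>
     prob_space M \<and> martingale M UNIV G S \<and> (\<forall>n. \<forall>\<omega>\<in>space M. 0 \<le> S n \<omega>) \<and>
     (\<exists>k\<ge>1. (\<integral>\<omega>. sampled_value S (drop_time S k) \<omega> \<partial>M) < (\<integral>\<omega>. S 0 \<omega> \<partial>M))"

definition tau_ab ::
  "(real \<Rightarrow> 'a \<Rightarrow> real) \<Rightarrow> (nat \<Rightarrow> real) \<Rightarrow> (nat \<Rightarrow> real) \<Rightarrow> nat \<Rightarrow> 'a \<Rightarrow> real"
where
  "tau_ab X a b n \<omega> =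
     (if n = 0 then 0
      else enn2real (min (INF t\<in>{t. 0 \<le> t \<and> b n \<le> X t \<omega>}. ennreal t) (ennreal (a n))))"

definition S_ab ::
  "(real \<Rightarrow> 'a \<Rightarrow> real) \<Rightarrow> (nat \<Rightarrow> real) \<Rightarrow> (nat \<Rightarrow> real) \<Rightarrow> nat \<Rightarrow> 'a \<Rightarrow> real"
where
  "S_ab X a b n \<omega> = X (tau_ab X a b n \<omega>) \<omega>"

end

theory Submission
  imports Defs
begin

text \<open>
  A positive local martingale \<open>X\<close> is a supermartingale, and it is strict only if
  \<open>E X\<^sub>T < E X\<^sub>0\<close> for some \<open>T\<close>. The sampled process \<open>S\<close> is a martingale because \<open>X\<close> is dominated by
  \<open>max X\<^sub>0 b\<^sub>n\<close> up to the hitting time of \<open>b\<^sub>n\<close>. Let \<open>N\<close> be such that \<open>a\<^sub>j > T\<close> for \<open>j \<ge> N\<close>, let \<open>\<kappa>\<close>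
  be the time of the \<open>N\<close>-th drop of \<open>S\<close>, and let \<open>D\<^sub>n\<close> be the event that \<open>X\<close> reaches \<open>b\<^sub>n\<close> by time
  \<open>T\<close>. On \<open>D\<^sub>n\<close> a drop at \<open>j \<le> n\<close> forces \<open>a\<^sub>j \<le> T\<close>, so \<open>\<kappa> > n\<close> there, and \<open>S\<close> stopped at
  \<open>\<kappa> \<and> n\<close> agrees on \<open>D\<^sub>n\<close> with \<open>X\<close> stopped at \<open>T\<close> or on reaching \<open>b\<^sub>n\<close>. Both have expectation
  \<open>E X\<^sub>0\<close>, so off \<open>D\<^sub>n\<close> the expectation of the stopped \<open>S\<close> is at most \<open>E X\<^sub>T\<close>. As \<open>D\<^sub>n\<close> shrinks to the
  empty set, Fatou's lemma gives \<open>E S\<^sub>\<kappa> \<le> E X\<^sub>T < E X\<^sub>0\<close>. The limit \<open>S\<^sub>\<infinity>\<close> is only needed on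
  \<open>{\<kappa> = \<infinity>}\<close>, where \<open>S\<close> is eventually nondecreasing, so no martingale convergence theorem enters.
\<close>

section \<open>Hitting times of continuous paths\<close>

text \<open>The infimum lives in \<open>ennreal\<close>, so a level never reached counts as
  infinity; the cap \<open>c\<close> makes the time finite, so \<open>enn2real\<close> loses
  nothing. With \<open>c = 0\<close> the time is constantly 0, which covers index 0 of
  \<open>tau_ab\<close>.\<close>

definition hit :: "(real \<Rightarrow> 'a \<Rightarrow> real) \<Rightarrow> real \<Rightarrow> real \<Rightarrow> 'a \<Rightarrow> real" where
  "hit X b c \<omega> = enn2real (min (INF t\<in>{t. 0 \<le> t \<and> b \<le> X t \<omega>}. ennreal t) (ennreal c))"

lemma hit_nonneg: "0 \<le> hit X b c \<omega>"
  by (simp add: hit_def)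

lemma hit_le: "0 \<le> c \<Longrightarrow> hit X b c \<omega> \<le> c"
  unfolding hit_def by (rule enn2real_leI) auto

lemma less_hit:
  assumes "0 \<le> t" "t < hit X b c \<omega>"
  shows "X t \<omega> < b"
proof (rule ccontr)
  assume "\<not> X t \<omega> < b"
  then have "(INF t\<in>{t. 0 \<le> t \<and> b \<le> X t \<omega>}. ennreal t) \<le> ennreal t"
    using assms by (intro INF_lower) auto
  then have "hit X b c \<omega> \<le> t"
    unfolding hit_def using assms by (intro enn2real_leI) (auto simp: min_le_iff_disj)
  with assms show False by simp
qed

text \<open>By continuity the times in \<open>{0..c}\<close> at which the path is at least
  \<open>b\<close> form a compact set. If it is nonempty, its minimum is the infimum; if it is
  empty, the time equals the cap \<open>c\<close>.\<close>

lemma hit_less_bound: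
  assumes cont: "continuous_on {0..} (\<lambda>t. X t \<omega>)" and "0 \<le> c" "hit X b c \<omega> < c"
  shows "b \<le> X (hit X b c \<omega>) \<omega>"
proof (cases "\<exists>s\<in>{0..c}. b \<le> X s \<omega>")
  case True
  let ?C = "{0..c} \<inter> (\<lambda>t. X t \<omega>) -` {b..}"
  have "closed ?C"
    by (intro continuous_closed_preimage continuous_on_subset[OF cont]) auto
  moreover have "bounded ?C"
    by (meson bounded_closed_interval bounded_subset inf_le1)
  ultimately have "compact ?C"
    by (simp add: compact_eq_bounded_closed)
  then obtain h where h: "h \<in> ?C" "\<And>s. s \<in> ?C \<Longrightarrow> h \<le> s"
    using True compact_attains_inf[of ?C] by fastforce
  have "(INF t\<in>{t. 0 \<le> t \<and> b \<le> X t \<omega>}. ennreal t) = ennreal h"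
  proof (rule antisym)
    show "ennreal h \<le> (INF t\<in>{t. 0 \<le> t \<and> b \<le> X t \<omega>}. ennreal t)"
    proof (rule INF_greatest)
      fix t assume t: "t \<in> {t. 0 \<le> t \<and> b \<le> X t \<omega>}"
      show "ennreal h \<le> ennreal t"
        using h(2)[of t] h(1) t by (cases "t \<le> c") (auto intro!: ennreal_leI)
    qed
  qed (use h in \<open>auto intro!: INF_lower\<close>)
  then have "hit X b c \<omega> = h"
    using h(1) by (simp add: hit_def min_def)
  with h show ?thesis by auto
next
  case False
  have "ennreal c \<le> (INF t\<in>{t. 0 \<le> t \<and> b \<le> X t \<omega>}. ennreal t)"
    using False by (intro INF_greatest ennreal_leI) force
  then have "hit X b c \<omega> = c"
    using assms by (simp add: hit_def min_absorb2)
  with assms show ?thesis by simp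
qed

text \<open>Since the infimum is attained, the event involves only the path on
  \<open>{0..t}\<close>. This makes the hitting time a stopping time without enlarging the
  filtration.\<close>

lemma hit_le_iff:
  assumes "continuous_on {0..} (\<lambda>t. X t \<omega>)" "0 \<le> c" "0 \<le> t"
  shows "hit X b c \<omega> \<le> t \<longleftrightarrow> c \<le> t \<or> (\<exists>s\<in>{0..t}. b \<le> X s \<omega>)"
proof
  assume *: "hit X b c \<omega> \<le> t"
  show "c \<le> t \<or> (\<exists>s\<in>{0..t}. b \<le> X s \<omega>)"
    using hit_less_bound[of X \<omega> c b, OF assms(1,2)] hit_nonneg[of X b c \<omega>] *
    by (cases "hit X b c \<omega> < c") auto
next
  assume "c \<le> t \<or> (\<exists>s\<in>{0..t}. b \<le> X s \<omega>)"
  then show "hit X b c \<omega> \<le> t"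
  proof
    assume "\<exists>s\<in>{0..t}. b \<le> X s \<omega>"
    then obtain s where "0 \<le> s" "s \<le> t" "b \<le> X s \<omega>" by auto
    then show ?thesis
      using less_hit[of s X b c \<omega>] by linarith
  qed (use hit_le[OF assms(2), of X b \<omega>] in linarith)
qed

lemma hit_mono:
  assumes "continuous_on {0..} (\<lambda>t. X t \<omega>)" "0 \<le> c" "c \<le> c'" "b \<le> b'"
  shows "hit X b c \<omega> \<le> hit X b' c' \<omega>"
proof (rule ccontr)
  assume *: "\<not> hit X b c \<omega> \<le> hit X b' c' \<omega>"
  then have "hit X b' c' \<omega> < c'"
    using hit_le[OF assms(2), of X b \<omega>] assms by linarith
  then have "b' \<le> X (hit X b' c' \<omega>) \<omega>"
    using assms hit_less_bound[of X \<omega> c' b', OF assms(1)] by simp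
  moreover have "X (hit X b' c' \<omega>) \<omega> < b"
    using * less_hit[of "hit X b' c' \<omega>" X b c \<omega>] hit_nonneg[of X b' c' \<omega>] by simp
  ultimately show False using assms by simp
qed

lemma hit_zero: "hit X b 0 \<omega> = 0"
  using hit_le[of 0 X b \<omega>] hit_nonneg[of X b 0 \<omega>] by simp

text \<open>Before the hitting time the path lies below \<open>b\<close>, and continuity extends
  this to the endpoint. The term \<open>X 0\<close> covers a hitting time of 0, as for a path that
  starts above \<open>b\<close>.\<close>

lemma le_hit_bound:
  assumes cont: "continuous_on {0..} (\<lambda>t. X t \<omega>)" and t: "0 \<le> t" "t \<le> hit X b c \<omega>"
  shows "X t \<omega> \<le> max (X 0 \<omega>) b"
proof (cases "hit X b c \<omega> = 0")
  case True
  then show ?thesis using t by simp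
next
  case False
  let ?h = "hit X b c \<omega>"
  have h: "0 < ?h" using False hit_nonneg[of X b c \<omega>] by simp
  have "X t \<omega> \<le> b"
  proof (rule continuous_le_on_closure[where S="{0..<?h}" and f="\<lambda>t. X t \<omega>"])
    show "continuous_on (closure {0..<?h}) (\<lambda>t. X t \<omega>)"
      using h by (auto intro!: continuous_on_subset[OF cont])
    show "t \<in> closure {0..<?h}" using h t by simp
  qed (use less_hit[of _ X b c \<omega>] in force)
  then show ?thesis by simp
qed

lemma floor_divide_bounds:
  fixes n u :: real
  assumes "0 < n"
  shows "of_int \<lfloor>n * u\<rfloor> / n \<le> u" "u - 1 / n \<le> of_int \<lfloor>n * u\<rfloor> / n"
    "0 \<le> u \<Longrightarrow> 0 \<le> of_int \<lfloor>n * u\<rfloor> / n"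
proof -
  show "of_int \<lfloor>n * u\<rfloor> / n \<le> u"
    using assms of_int_floor_le[of "n * u"] by (simp add: divide_le_eq mult.commute)
  have "n * u - 1 \<le> of_int \<lfloor>n * u\<rfloor>" by linarith
  then have "(n * u - 1) / n \<le> of_int \<lfloor>n * u\<rfloor> / n"
    using assms by (intro divide_right_mono) auto
  then show "u - 1 / n \<le> of_int \<lfloor>n * u\<rfloor> / n"
    using assms by (simp add: diff_divide_distrib)
qed (use assms in auto)

text \<open>Horizon 0 forces the time 0 at index 0. Reusing the level \<open>b 1\<close> there
  extends the levels monotonically, as \<open>b\<close> is controlled only from index 1 on.\<close>

lemma tau_ab_eq_hit: "tau_ab X a b n = hit X (b (max 1 n)) (if n = 0 then 0 else a n)"
proof
  fix \<omega>
  show "tau_ab X a b n \<omega> = hit X (b (max 1 n)) (if n = 0 then 0 else a n) \<omega>"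
    by (cases n) (simp_all add: tau_ab_def hit_zero, simp add: hit_def)
qed

section \<open>Filtered probability spaces and the past of a stopping time\<close>

locale filtered_prob_space = prob_space M + filtration "space M" F
  for M :: "'a measure" and F :: "real \<Rightarrow> 'a measure" +
  assumes subalgebra_F: "subalgebra M (F t)"
begin

lemma sets_F_M: "A \<in> sets (F t) \<Longrightarrow> A \<in> sets M"
  using subalgebra_F[of t] by (auto simp: subalgebra_def)

lemma measurable_F_M: "f \<in> borel_measurable (F t) \<Longrightarrow> f \<in> borel_measurable M"
  by (rule measurable_from_subalg[OF subalgebra_F])

lemma measurable_F_mono: "s \<le> t \<Longrightarrow> f \<in> borel_measurable (F s) \<Longrightarrow> f \<in> borel_measurable (F t)"
  using sets_F_mono[of s t] by (auto simp: measurable_def space_F)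

lemma measurable_stopping_time_M: "stopping_time F T \<Longrightarrow> T \<in> borel_measurable M"
  by (rule measurable_stopping_time[of F]) (auto simp: space_F sets_F_M)

lemma measurable_min_stopping_time:
  assumes "stopping_time F T"
  shows "(\<lambda>\<omega>. min (T \<omega>) t) \<in> borel_measurable (F t)"
proof (rule borel_measurableI_le)
  fix y
  show "{\<omega> \<in> space (F t). min (T \<omega>) t \<le> y} \<in> sets (F t)"
  proof (cases "t \<le> y")
    case False
    then show ?thesis
      using stopping_time_le_const[OF assms, of y t] by (simp add: min_le_iff_disj pred_def)
  qed (simp add: min_le_iff_disj)
qed

lemma subalgebra_pre_sigma:
  assumes "stopping_time F T"
  shows "subalgebra M (pre_sigma T)"
  unfolding subalgebra_def
proof (intro conjI subsetI)
  fix A assume A: "A \<in> sets (pre_sigma T)"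
  \<comment> \<open>Membership in \<open>pre_sigma T\<close> speaks only about the parts of
    \<open>A\<close> where \<open>T\<close> is bounded; integer bounds exhaust
    \<open>A\<close>.\<close>
  have "(\<Union>n::nat. {\<omega>\<in>A. T \<omega> \<le> real n}) \<in> sets M"
    using sets_pre_sigmaD[OF assms A] sets_F_M by blast
  also have "(\<Union>n::nat. {\<omega>\<in>A. T \<omega> \<le> real n}) = A"
    using real_arch_simple by auto
  finally show "A \<in> sets M" .
qed (rule space_pre_sigma)

end

section \<open>Measurability of hitting times and of sampled values\<close>

locale continuous_process = filtered_prob_space +
  fixes X :: "real \<Rightarrow> 'a \<Rightarrow> real"
  assumes adapted: "0 \<le> t \<Longrightarrow> X t \<in> borel_measurable (F t)"
    and continuous: "\<omega> \<in> space M \<Longrightarrow> continuous_on {0..} (\<lambda>t. X t \<omega>)"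
    and pos: "0 \<le> t \<Longrightarrow> \<omega> \<in> space M \<Longrightarrow> 0 < X t \<omega>"
begin

text \<open>Turns an uncountable union over times into countable operations. Relaxing the level by
  \<open>1 / (real k + 1)\<close> makes room for approximation by rational times; conversely, the
  maximum of the path on \<open>{0..t}\<close> exceeds every relaxed level, hence is at least
  \<open>c\<close>.\<close>

lemma path_exceeds_iff_rational:
  assumes \<omega>: "\<omega> \<in> space M" and t: "0 \<le> t"
  shows "(\<exists>s\<in>{0..t}. c \<le> X s \<omega>) \<longleftrightarrow>
    (\<forall>k::nat. \<exists>q\<in>insert t (\<rat> \<inter> {0..t}). c - 1 / (real k + 1) < X q \<omega>)" (is "?L \<longleftrightarrow> ?R")
proof
  assume ?L
  then obtain s where s: "0 \<le> s" "s \<le> t" "c \<le> X s \<omega>" by auto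
  show ?R
  proof (rule ccontr)
    assume "\<not> ?R"
    then obtain k where k: "\<And>q. q \<in> insert t (\<rat> \<inter> {0..t}) \<Longrightarrow> X q \<omega> \<le> c - 1 / (real k + 1)"
      by (metis not_less)
    have "X s \<omega> \<le> c - 1 / (real k + 1)"
    proof (cases "t = 0")
      case True
      then show ?thesis using k[of t] s by simp
    next
      case False
      have cl: "closure ({0<..<t} \<inter> \<rat>) = {0..t}"
        using closure_open_Int_superset[of "{0<..<t}" \<rat>] False t by (simp add: Rats_closure_real)
      show ?thesis
        by (rule continuous_le_on_closure[where S="{0<..<t} \<inter> \<rat>" and f="\<lambda>t. X t \<omega>"])
           (use s k in \<open>auto simp: cl intro!: continuous_on_subset[OF continuous[OF \<omega>]]\<close>)
    qed
    moreover have "0 < 1 / (real k + 1)" by simp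
    ultimately show False using s(3) by linarith
  qed
next
  assume R: ?R
  have "continuous_on {0..t} (\<lambda>t. X t \<omega>)"
    by (rule continuous_on_subset[OF continuous[OF \<omega>]]) auto
  then obtain m where m: "m \<in> {0..t}" "\<And>y. y \<in> {0..t} \<Longrightarrow> X y \<omega> \<le> X m \<omega>"
    using continuous_attains_sup[of "{0..t}" "\<lambda>t. X t \<omega>"] t by auto
  have "c - 1 / (real k + 1) \<le> X m \<omega>" for k
  proof -
    obtain q where "q \<in> {0..t}" "c - 1 / (real k + 1) < X q \<omega>"
      using R[rule_format, of k] t by auto
    then show ?thesis using m(2)[of q] by simp
  qed
  moreover have "(\<lambda>k. c - 1 / (real k + 1)) \<longlonglongrightarrow> c - 0"
    by (intro tendsto_intros) (use LIMSEQ_inverse_real_of_nat in \<open>simp add: inverse_eq_divide add.commute\<close>)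
  ultimately have "c \<le> X m \<omega>"
    using LIMSEQ_le_const2[of "\<lambda>k. c - 1 / (real k + 1)" c "X m \<omega>"] by auto
  with m show ?L by auto
qed

lemma path_exceeds_measurable:
  assumes "0 \<le> t"
  shows "Measurable.pred (F t) (\<lambda>\<omega>. \<exists>s\<in>{0..t}. c \<le> X s \<omega>)"
proof (subst measurable_cong[OF path_exceeds_iff_rational])
  have "q \<in> insert t (\<rat> \<inter> {0..t}) \<Longrightarrow> X q \<in> borel_measurable (F t)" for q
    using adapted[of q] measurable_F_mono[of q t] assms by auto
  then have "q \<in> insert t (\<rat> \<inter> {0..t}) \<Longrightarrow>
      Measurable.pred (F t) (\<lambda>\<omega>. c - 1 / (real k + 1) < X q \<omega>)" for q and k :: nat
    by measurable
  then show "Measurable.pred (F t) (\<lambda>\<omega>. \<forall>k::nat. \<exists>q\<in>insert t (\<rat> \<inter> {0..t}). c - 1 / (real k + 1) < X q \<omega>)"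
    by (intro pred_intros_countable measurable_pred_countable countable_insert
        countable_Int1 countable_rat) auto
qed (use assms in \<open>auto simp: space_F\<close>)

lemma stopping_time_hit:
  assumes "0 \<le> c"
  shows "stopping_time F (hit X b c)"
proof
  fix t
  show "Measurable.pred (F t) (\<lambda>\<omega>. hit X b c \<omega> \<le> t)"
  proof (cases "0 \<le> t")
    case True
    have *: "Measurable.pred (F t) (\<lambda>\<omega>. c \<le> t \<or> (\<exists>s\<in>{0..t}. b \<le> X s \<omega>))"
      using path_exceeds_measurable[OF True, of b] by (intro pred_intros_logic) auto
    have "hit X b c \<omega> \<le> t \<longleftrightarrow> c \<le> t \<or> (\<exists>s\<in>{0..t}. b \<le> X s \<omega>)"
      if "\<omega> \<in> space (F t)" for \<omega>
      using that assms True by (intro hit_le_iff continuous) (auto simp: space_F)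
    then show ?thesis
      by (rule measurable_cong[THEN iffD2, OF _ *])
  next
    case False
    then have "\<not> hit X b c \<omega> \<le> t" for \<omega>
      using hit_nonneg[of X b c \<omega>] by linarith
    then show ?thesis by simp
  qed
qed

lemma measurable_at_stopping_time:
  assumes T: "stopping_time F T" and nonneg: "\<And>\<omega>. 0 \<le> T \<omega>"
  shows "(\<lambda>\<omega>. X (T \<omega>) \<omega>) \<in> borel_measurable (pre_sigma T)"
proof -
  have meas: "(\<lambda>\<omega>. X (min (T \<omega>) t) \<omega>) \<in> borel_measurable (F t)" if t: "0 \<le> t" for t
  proof (rule borel_measurable_LIMSEQ_real)
    \<comment> \<open>Rounding down keeps the approximating times in \<open>{0..t}\<close>, where
      \<open>X\<close> is known to \<open>F t\<close>.\<close>
    define d where "d k \<omega> = of_int \<lfloor>real (Suc k) * min (T \<omega>) t\<rfloor> / real (Suc k)" for k \<omega>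
    have d: "d k \<omega> \<le> min (T \<omega>) t" "0 \<le> d k \<omega>" "min (T \<omega>) t - 1 / real (Suc k) \<le> d k \<omega>" for k \<omega>
      unfolding d_def using nonneg[of \<omega>] t by (intro floor_divide_bounds; simp)+
    \<comment> \<open>The clamp makes every integer index, attained or not, yield an
      \<open>F t\<close>-measurable function.\<close>
    show "(\<lambda>\<omega>. X (max 0 (min t (d k \<omega>))) \<omega>) \<in> borel_measurable (F t)" for k
      unfolding d_def
    proof (rule measurable_compose_countable
        [where f="\<lambda>i \<omega>. X (max 0 (min t (of_int i / real (Suc k)))) \<omega>"
           and g="\<lambda>\<omega>. \<lfloor>real (Suc k) * min (T \<omega>) t\<rfloor>"])
      show "X (max 0 (min t (of_int i / real (Suc k)))) \<in> borel_measurable (F t)" for i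
        by (rule measurable_F_mono[OF _ adapted]) (use t in auto)
      show "(\<lambda>\<omega>. \<lfloor>real (Suc k) * min (T \<omega>) t\<rfloor>) \<in> F t \<rightarrow>\<^sub>M count_space UNIV"
        by (intro measurable_compose[OF _ measurable_real_floor] borel_measurable_times
            borel_measurable_const measurable_min_stopping_time T)
    qed
    fix \<omega> assume "\<omega> \<in> space (F t)"
    then have \<omega>: "\<omega> \<in> space M" by (simp add: space_F)
    have lim: "(\<lambda>k. d k \<omega>) \<longlonglongrightarrow> min (T \<omega>) t"
    proof (rule tendsto_sandwich)
      show "(\<lambda>k. min (T \<omega>) t - 1 / real (Suc k)) \<longlonglongrightarrow> min (T \<omega>) t"
        using tendsto_diff[OF tendsto_const LIMSEQ_inverse_real_of_nat, of "min (T \<omega>) t"]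
        by (simp add: inverse_eq_divide)
    qed (rule tendsto_const always_eventually allI d)+
    have "max 0 (min t (d k \<omega>)) = d k \<omega>" for k
      using d(1,2)[of k \<omega>] by simp
    then have "(\<lambda>k. max 0 (min t (d k \<omega>))) \<longlonglongrightarrow> min (T \<omega>) t"
      by (simp only: lim)
    then show "(\<lambda>k. X (max 0 (min t (d k \<omega>))) \<omega>) \<longlonglongrightarrow> X (min (T \<omega>) t) \<omega>"
      by (rule continuous_on_tendsto_compose[OF continuous[OF \<omega>]])
         (use nonneg t in auto)
  qed
  show ?thesis
  proof (rule borel_measurableI_le, rule sets_pre_sigmaI[OF T])
    fix y t
    show "{\<omega> \<in> {\<omega> \<in> space (pre_sigma T). X (T \<omega>) \<omega> \<le> y}. T \<omega> \<le> t} \<in> sets (F t)"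
    proof (cases "0 \<le> t")
      case True
      note [measurable] = meas[OF True] stopping_timeD[OF T, of t]
      have "{\<omega> \<in> space (F t). X (min (T \<omega>) t) \<omega> \<le> y \<and> T \<omega> \<le> t} \<in> sets (F t)"
        by measurable
      also have "{\<omega> \<in> space (F t). X (min (T \<omega>) t) \<omega> \<le> y \<and> T \<omega> \<le> t} =
          {\<omega> \<in> {\<omega> \<in> space (pre_sigma T). X (T \<omega>) \<omega> \<le> y}. T \<omega> \<le> t}"
        by (auto simp: space_F space_pre_sigma min_def)
      finally show ?thesis .
    next
      case False
      then have "\<not> T \<omega> \<le> t" for \<omega>
        using nonneg[of \<omega>] by linarith
      then show ?thesis by simp
    qed
  qed
qed

end

section \<open>Optional sampling for positive continuous martingales\<close>

text \<open>Fatou's lemma under a bound uniform in \<open>k\<close>. The limit is exchanged almost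
  everywhere for the liminf, which inherits measurability from the \<open>f k\<close>.\<close>

lemma nn_integral_le_of_tendsto:
  fixes f :: "nat \<Rightarrow> 'a \<Rightarrow> real"
  assumes [measurable]: "\<And>k. f k \<in> borel_measurable M"
    and lim: "AE \<omega> in M. (\<lambda>k. f k \<omega>) \<longlonglongrightarrow> g \<omega>"
    and le: "\<And>k. (\<integral>\<^sup>+\<omega>. ennreal (f k \<omega>) \<partial>M) \<le> C"
  shows "(\<integral>\<^sup>+\<omega>. ennreal (g \<omega>) \<partial>M) \<le> C"
proof -
  have "(\<integral>\<^sup>+\<omega>. ennreal (g \<omega>) \<partial>M) = (\<integral>\<^sup>+\<omega>. liminf (\<lambda>k. ennreal (f k \<omega>)) \<partial>M)"
  proof (rule nn_integral_cong_AE, use lim in eventually_elim)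
    fix \<omega> assume "(\<lambda>k. f k \<omega>) \<longlonglongrightarrow> g \<omega>"
    then have "(\<lambda>k. ennreal (f k \<omega>)) \<longlonglongrightarrow> ennreal (g \<omega>)"
      by (rule tendsto_ennrealI)
    then show "ennreal (g \<omega>) = liminf (\<lambda>k. ennreal (f k \<omega>))"
      by (simp add: lim_imp_Liminf)
  qed
  also have "\<dots> \<le> liminf (\<lambda>k. \<integral>\<^sup>+\<omega>. ennreal (f k \<omega>) \<partial>M)"
    by (rule nn_integral_liminf) measurable
  also have "\<dots> \<le> limsup (\<lambda>k. \<integral>\<^sup>+\<omega>. ennreal (f k \<omega>) \<partial>M)"
    by (rule Liminf_le_Limsup) simp
  also have "\<dots> \<le> C"
    by (rule Limsup_bounded) (simp add: le)
  finally show ?thesis .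
qed

lemma set_nn_integral_le_of_tendsto:
  fixes f :: "nat \<Rightarrow> 'a \<Rightarrow> real"
  assumes [measurable]: "\<And>k. f k \<in> borel_measurable M" "\<And>k. A k \<in> sets M"
    and lim: "AE \<omega> in M. (\<lambda>k. f k \<omega> * indicator (A k) \<omega>) \<longlonglongrightarrow> g \<omega> * indicator B \<omega>"
    and le: "\<And>k. (\<integral>\<^sup>+\<omega>\<in>A k. ennreal (f k \<omega>) \<partial>M) \<le> C"
  shows "(\<integral>\<^sup>+\<omega>\<in>B. ennreal (g \<omega>) \<partial>M) \<le> C"
proof -
  have eq: "ennreal (h \<omega>) * indicator D \<omega> = ennreal (h \<omega> * indicator D \<omega>)" for h :: "'a \<Rightarrow> real" and D \<omega>
    by (simp add: indicator_def)
  show ?thesis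
    unfolding eq
    by (rule nn_integral_le_of_tendsto[OF _ lim]) (use le in \<open>auto simp: eq\<close>)
qed

lemma set_nn_integral_eq_set_integral:
  fixes f :: "'a \<Rightarrow> real"
  assumes f: "integrable M f" and nonneg: "\<And>\<omega>. \<omega> \<in> space M \<Longrightarrow> 0 \<le> f \<omega>" and A: "A \<in> sets M"
  shows "(\<integral>\<^sup>+\<omega>\<in>A. ennreal (f \<omega>) \<partial>M) = ennreal (\<integral>\<omega>\<in>A. f \<omega> \<partial>M)"
proof -
  have "(\<integral>\<^sup>+\<omega>\<in>A. ennreal (f \<omega>) \<partial>M) = (\<integral>\<^sup>+\<omega>. ennreal (indicator A \<omega> *\<^sub>R f \<omega>) \<partial>M)"
    by (intro nn_integral_cong) (simp add: indicator_def)
  also have "\<dots> = ennreal (\<integral>\<omega>. indicator A \<omega> *\<^sub>R f \<omega> \<partial>M)"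
    by (intro nn_integral_eq_integral integrable_mult_indicator A f)
       (auto intro!: AE_I2 simp: nonneg)
  finally show ?thesis by (simp add: set_lebesgue_integral_def)
qed

lemma nn_integral_split_complement:
  fixes f :: "'a \<Rightarrow> ennreal"
  assumes "f \<in> borel_measurable M" "A \<in> sets M"
  shows "(\<integral>\<^sup>+\<omega>. f \<omega> \<partial>M) = (\<integral>\<^sup>+\<omega>\<in>A. f \<omega> \<partial>M) + (\<integral>\<^sup>+\<omega>\<in>space M - A. f \<omega> \<partial>M)"
proof -
  have "(\<integral>\<^sup>+\<omega>. f \<omega> \<partial>M) = (\<integral>\<^sup>+\<omega>\<in>A \<union> (space M - A). f \<omega> \<partial>M)"
    by (intro nn_integral_cong) (simp add: indicator_def)
  also have "\<dots> = (\<integral>\<^sup>+\<omega>\<in>A. f \<omega> \<partial>M) + (\<integral>\<^sup>+\<omega>\<in>space M - A. f \<omega> \<partial>M)"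
    by (rule nn_integral_disjoint_pair) (use assms in auto)
  finally show ?thesis .
qed

text \<open>Conditional expectations are determined by integrals over events, and nonnegativity
  turns these into integrals in \<open>ennreal\<close>, where Fatou's lemma and monotonicity apply
  directly. The martingale arguments below use this form.\<close>

lemma (in prob_space) martingale_iff_set_nn_integral:
  assumes filt: "filtration (space M) F" and sub: "\<And>t. subalgebra M (F t)"
    and adapted: "\<And>t. t \<in> I \<Longrightarrow> X t \<in> borel_measurable (F t)"
    and int: "\<And>t. t \<in> I \<Longrightarrow> integrable M (X t)"
    and nonneg: "\<And>t \<omega>. t \<in> I \<Longrightarrow> \<omega> \<in> space M \<Longrightarrow> 0 \<le> X t \<omega>"
  shows "martingale M I F X \<longleftrightarrow>
    (\<forall>s\<in>I. \<forall>t\<in>I. s \<le> t \<longrightarrow> (\<forall>A\<in>sets (F s).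
       (\<integral>\<^sup>+\<omega>\<in>A. ennreal (X t \<omega>) \<partial>M) = (\<integral>\<^sup>+\<omega>\<in>A. ennreal (X s \<omega>) \<partial>M)))"
proof -
  \<comment> \<open>Both integrals are finite and nonnegative, so \<open>ennreal\<close> is
    injective on them.\<close>
  have set_eq: "(\<integral>\<^sup>+\<omega>\<in>A. ennreal (X t \<omega>) \<partial>M) = (\<integral>\<^sup>+\<omega>\<in>A. ennreal (X s \<omega>) \<partial>M) \<longleftrightarrow>
      (\<integral>\<omega>\<in>A. X t \<omega> \<partial>M) = (\<integral>\<omega>\<in>A. X s \<omega> \<partial>M)"
    if "s \<in> I" "t \<in> I" "A \<in> sets (F s)" for s t A
  proof -
    have A: "A \<in> sets M" using sub[of s] that by (auto simp: subalgebra_def)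
    have "0 \<le> (\<integral>\<omega>\<in>A. X u \<omega> \<partial>M)" if "u \<in> I" for u
      unfolding set_lebesgue_integral_def
      by (rule Bochner_Integration.integral_nonneg) (use nonneg[OF that] in auto)
    then show ?thesis
      using that by (simp add: set_nn_integral_eq_set_integral int nonneg A)
  qed
  have "(AE \<omega> in M. real_cond_exp M (F s) (X t) \<omega> = X s \<omega>) \<longleftrightarrow>
      (\<forall>A\<in>sets (F s). (\<integral>\<omega>\<in>A. X t \<omega> \<partial>M) = (\<integral>\<omega>\<in>A. X s \<omega> \<partial>M))"
    if st: "s \<in> I" "t \<in> I" for s t
  proof -
    interpret finite_measure_subalgebra M "F s"
      by unfold_locales (rule sub)
    show ?thesis
    proof (intro iffI ballI)
      fix A assume ae: "AE \<omega> in M. real_cond_exp M (F s) (X t) \<omega> = X s \<omega>" and A: "A \<in> sets (F s)"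
      have "(\<integral>\<omega>\<in>A. X t \<omega> \<partial>M) = (\<integral>\<omega>\<in>A. real_cond_exp M (F s) (X t) \<omega> \<partial>M)"
        by (rule real_cond_exp_intA[OF int[OF st(2)] A])
      also have "\<dots> = (\<integral>\<omega>\<in>A. X s \<omega> \<partial>M)"
        unfolding set_lebesgue_integral_def
      proof (rule integral_cong_AE)
        have [measurable]: "A \<in> sets M" using sub[of s] A by (auto simp: subalgebra_def)
        show "(\<lambda>\<omega>. indicat_real A \<omega> *\<^sub>R X s \<omega>) \<in> borel_measurable M"
          using int[OF st(1)] by measurable
      qed (use ae A sub[of s] in \<open>auto simp: subalgebra_def\<close>)
      finally show "(\<integral>\<omega>\<in>A. X t \<omega> \<partial>M) = (\<integral>\<omega>\<in>A. X s \<omega> \<partial>M)" .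
    next
      assume "\<forall>A\<in>sets (F s). (\<integral>\<omega>\<in>A. X t \<omega> \<partial>M) = (\<integral>\<omega>\<in>A. X s \<omega> \<partial>M)"
      then show "AE \<omega> in M. real_cond_exp M (F s) (X t) \<omega> = X s \<omega>"
        by (intro real_cond_exp_charact) (auto intro: int adapted st)
    qed
  qed
  then show ?thesis
    unfolding martingale_def using filt sub adapted int by (simp add: set_eq)
qed

section \<open>Rounding stopping times up\<close>

lemma ceiling_divide_bounds:
  fixes n u :: real
  assumes "0 < n" "0 \<le> u"
  shows "u \<le> real (nat \<lceil>n * u\<rceil>) / n" "real (nat \<lceil>n * u\<rceil>) / n \<le> u + 1 / n"
proof -
  have "real (nat \<lceil>n * u\<rceil>) = of_int \<lceil>n * u\<rceil>" using assms by simp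
  moreover have "n * u \<le> of_int \<lceil>n * u\<rceil>" "of_int \<lceil>n * u\<rceil> \<le> n * u + 1" by linarith+
  ultimately show "u \<le> real (nat \<lceil>n * u\<rceil>) / n" "real (nat \<lceil>n * u\<rceil>) / n \<le> u + 1 / n"
    using assms by (simp_all add: field_simps)
qed

lemma measurable_nat_ceiling:
  fixes n :: real
  assumes "f \<in> borel_measurable N"
  shows "(\<lambda>\<omega>. nat \<lceil>n * f \<omega>\<rceil>) \<in> N \<rightarrow>\<^sub>M count_space UNIV"
proof -
  have "(\<lambda>\<omega>. \<lceil>n * f \<omega>\<rceil>) \<in> N \<rightarrow>\<^sub>M count_space UNIV"
    by (intro measurable_compose[OF _ measurable_real_ceiling] borel_measurable_times
        borel_measurable_const assms)
  then show ?thesis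
    by (rule measurable_compose) simp
qed

context continuous_process
begin

lemma continuous_on_at_discretization:
  fixes \<tau> T :: real
  assumes "\<omega> \<in> space M" "0 \<le> \<tau>" "\<tau> \<le> T"
  shows "(\<lambda>k. X (min T (real (nat \<lceil>real (Suc k) * \<tau>\<rceil>) / real (Suc k))) \<omega>) \<longlonglongrightarrow> X \<tau> \<omega>"
proof -
  define d where "d k = real (nat \<lceil>real (Suc k) * \<tau>\<rceil>) / real (Suc k)" for k
  have d: "\<tau> \<le> d k" "d k \<le> \<tau> + 1 / real (Suc k)" for k
    unfolding d_def using assms by (intro ceiling_divide_bounds; simp)+
  have "d \<longlonglongrightarrow> \<tau>"
  proof (rule tendsto_sandwich[where f="\<lambda>_. \<tau>"])
    show "(\<lambda>k. \<tau> + 1 / real (Suc k)) \<longlonglongrightarrow> \<tau>"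
      using tendsto_add[OF tendsto_const LIMSEQ_inverse_real_of_nat, of \<tau>]
      by (simp add: inverse_eq_divide)
    show "\<forall>\<^sub>F k in sequentially. \<tau> \<le> d k" "\<forall>\<^sub>F k in sequentially. d k \<le> \<tau> + 1 / real (Suc k)"
      using d by (auto intro!: always_eventually simp del: of_nat_Suc)
  qed (rule tendsto_const)
  then have "(\<lambda>k. min T (d k)) \<longlonglongrightarrow> min T \<tau>"
    by (intro tendsto_intros)
  then have lim: "(\<lambda>k. min T (d k)) \<longlonglongrightarrow> \<tau>"
    using assms by simp
  have "0 \<le> min T (d k)" for k
    using d(1)[of k] assms by simp
  then have "(\<lambda>k. X (min T (d k)) \<omega>) \<longlonglongrightarrow> X \<tau> \<omega>"
    by (intro continuous_on_tendsto_compose[OF continuous[OF assms(1)] lim])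
       (use assms in \<open>auto intro: always_eventually\<close>)
  then show ?thesis by (simp add: d_def)
qed

text \<open>Rounding up makes the level set known at the rounded time: on it \<open>\<tau>\<close>
  is at most \<open>min T (real i / n)\<close>. Freezing \<open>\<tau>\<close> at that time gives
  measurability and changes nothing on the level set.\<close>

lemma discretization_level_set:
  assumes \<tau>: "stopping_time F \<tau>" and bounds: "\<And>\<omega>. 0 \<le> \<tau> \<omega>" "\<And>\<omega>. \<tau> \<omega> \<le> T"
    and A: "A \<in> sets (pre_sigma \<tau>)" and n: "0 < (n::real)"
  shows "{\<omega>\<in>A. nat \<lceil>n * \<tau> \<omega>\<rceil> = i} \<in> sets (F (min T (real i / n)))"
proof -
  let ?t = "min T (real i / n)"
  have "(\<lambda>\<omega>. nat \<lceil>n * min (\<tau> \<omega>) ?t\<rceil>) \<in> F ?t \<rightarrow>\<^sub>M count_space UNIV"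
    by (intro measurable_nat_ceiling measurable_min_stopping_time \<tau>)
  from measurable_sets[OF this, of "{i}"]
  have "{\<omega>\<in>A. \<tau> \<omega> \<le> ?t} \<inter> ((\<lambda>\<omega>. nat \<lceil>n * min (\<tau> \<omega>) ?t\<rceil>) -` {i} \<inter> space (F ?t)) \<in> sets (F ?t)"
    using sets_pre_sigmaD[OF \<tau> A, of ?t] by auto
  also have "{\<omega>\<in>A. \<tau> \<omega> \<le> ?t} \<inter> ((\<lambda>\<omega>. nat \<lceil>n * min (\<tau> \<omega>) ?t\<rceil>) -` {i} \<inter> space (F ?t)) =
      {\<omega>\<in>A. nat \<lceil>n * \<tau> \<omega>\<rceil> = i}"
  proof -
    have "A \<subseteq> space M"
      using sets.sets_into_space[OF A] by (simp add: space_pre_sigma)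
    moreover have "\<tau> \<omega> \<le> ?t" if "nat \<lceil>n * \<tau> \<omega>\<rceil> = i" for \<omega>
      using ceiling_divide_bounds(1)[OF n bounds(1), of \<omega>] bounds(2)[of \<omega>] that by auto
    ultimately show ?thesis
      by (auto simp: space_F simp del: min_less_iff_conj min.bounded_iff)
  qed
  finally show ?thesis .
qed

text \<open>The rounded time is constant on each level set, so sampling at a random time becomes a
  countable sum of integrals at fixed times. The function \<open>f\<close> will be the identity or a
  truncation.\<close>

lemma set_nn_integral_discretization:
  fixes f :: "real \<Rightarrow> real" and T :: real and k :: nat
  defines "n \<equiv> real (Suc k)"
  assumes f: "f \<in> borel_measurable borel"
    and \<tau>: "stopping_time F \<tau>" and bounds: "\<And>\<omega>. 0 \<le> \<tau> \<omega>" "\<And>\<omega>. \<tau> \<omega> \<le> T" and T: "0 \<le> T"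
    and A: "A \<in> sets (pre_sigma \<tau>)"
  shows "(\<lambda>\<omega>. f (X (min T (real (nat \<lceil>n * \<tau> \<omega>\<rceil>) / n)) \<omega>)) \<in> borel_measurable M"
    and "(\<integral>\<^sup>+\<omega>\<in>A. ennreal (f (X (min T (real (nat \<lceil>n * \<tau> \<omega>\<rceil>) / n)) \<omega>)) \<partial>M) =
      (\<Sum>i. \<integral>\<^sup>+\<omega>\<in>{\<omega>\<in>A. nat \<lceil>n * \<tau> \<omega>\<rceil> = i}. ennreal (f (X (min T (real i / n)) \<omega>)) \<partial>M)"
    and "(\<integral>\<^sup>+\<omega>\<in>A. ennreal (f (X T \<omega>)) \<partial>M) =
      (\<Sum>i. \<integral>\<^sup>+\<omega>\<in>{\<omega>\<in>A. nat \<lceil>n * \<tau> \<omega>\<rceil> = i}. ennreal (f (X T \<omega>)) \<partial>M)"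
proof -
  have n: "0 < n" by (simp add: n_def)
  define B where "B i = {\<omega>\<in>A. nat \<lceil>n * \<tau> \<omega>\<rceil> = i}" for i
  have B: "B i \<in> sets M" for i
    unfolding B_def using discretization_level_set[OF \<tau> bounds A n] by (rule sets_F_M)
  have disj: "disjoint_family B" by (auto simp: disjoint_family_on_def B_def)
  have A_eq: "A = (\<Union>i. B i)" by (auto simp: B_def)
  have meas: "(\<lambda>\<omega>. f (X (min T (real i / n)) \<omega>)) \<in> borel_measurable M" for i
    by (rule measurable_compose[OF measurable_F_M[OF adapted] f]) (use T n in auto)
  have idx: "(\<lambda>\<omega>. nat \<lceil>n * \<tau> \<omega>\<rceil>) \<in> M \<rightarrow>\<^sub>M count_space UNIV"
    by (intro measurable_nat_ceiling measurable_stopping_time_M \<tau>)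
  show *: "(\<lambda>\<omega>. f (X (min T (real (nat \<lceil>n * \<tau> \<omega>\<rceil>) / n)) \<omega>)) \<in> borel_measurable M"
    by (rule measurable_compose_countable[OF meas idx])
  have "(\<integral>\<^sup>+\<omega>\<in>A. ennreal (f (X (min T (real (nat \<lceil>n * \<tau> \<omega>\<rceil>) / n)) \<omega>)) \<partial>M) =
      (\<Sum>i. \<integral>\<^sup>+\<omega>\<in>B i. ennreal (f (X (min T (real (nat \<lceil>n * \<tau> \<omega>\<rceil>) / n)) \<omega>)) \<partial>M)"
    unfolding A_eq by (rule nn_integral_disjoint_family[OF measurable_compose[OF * measurable_ennreal] B disj])
  also have "\<dots> = (\<Sum>i. \<integral>\<^sup>+\<omega>\<in>B i. ennreal (f (X (min T (real i / n)) \<omega>)) \<partial>M)"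
    by (intro suminf_cong nn_integral_cong) (auto simp: B_def indicator_def)
  finally show "(\<integral>\<^sup>+\<omega>\<in>A. ennreal (f (X (min T (real (nat \<lceil>n * \<tau> \<omega>\<rceil>) / n)) \<omega>)) \<partial>M) =
      (\<Sum>i. \<integral>\<^sup>+\<omega>\<in>{\<omega>\<in>A. nat \<lceil>n * \<tau> \<omega>\<rceil> = i}. ennreal (f (X (min T (real i / n)) \<omega>)) \<partial>M)"
    by (simp only: B_def)
  have "(\<lambda>\<omega>. ennreal (f (X T \<omega>))) \<in> borel_measurable M"
    by (intro measurable_compose[OF _ measurable_ennreal] measurable_compose[OF measurable_F_M[OF adapted[OF T]] f])
  from nn_integral_disjoint_family[OF this B disj]
  show "(\<integral>\<^sup>+\<omega>\<in>A. ennreal (f (X T \<omega>)) \<partial>M) =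
      (\<Sum>i. \<integral>\<^sup>+\<omega>\<in>{\<omega>\<in>A. nat \<lceil>n * \<tau> \<omega>\<rceil> = i}. ennreal (f (X T \<omega>)) \<partial>M)"
    by (simp only: A_eq[symmetric]) (simp only: B_def)
qed

text \<open>Truncation is concave, so it turns a martingale into a supermartingale. Where
  \<open>X s\<close> is at most \<open>c\<close>, truncation acts only at time \<open>t\<close> and
  can only lower the integral; elsewhere the truncated value at \<open>s\<close> is already the
  maximum \<open>c\<close>.\<close>

lemma set_nn_integral_truncation_le:
  assumes mart: "\<And>B. B \<in> sets (F s) \<Longrightarrow>
      (\<integral>\<^sup>+\<omega>\<in>B. ennreal (X t \<omega>) \<partial>M) = (\<integral>\<^sup>+\<omega>\<in>B. ennreal (X s \<omega>) \<partial>M)"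
    and st: "0 \<le> s" "0 \<le> t" and A: "A \<in> sets (F s)"
  shows "(\<integral>\<^sup>+\<omega>\<in>A. ennreal (min (X t \<omega>) c) \<partial>M) \<le> (\<integral>\<^sup>+\<omega>\<in>A. ennreal (min (X s \<omega>) c) \<partial>M)"
proof -
  have X[measurable]: "X s \<in> borel_measurable M" "X t \<in> borel_measurable M"
    using adapted measurable_F_M st by blast+
  define B where "B = A \<inter> (X s -` {..c} \<inter> space (F s))"
  define C where "C = A - B"
  have BF: "B \<in> sets (F s)"
    unfolding B_def by (intro sets.Int A measurable_sets[OF adapted[OF st(1)]]) simp
  then have BC[measurable]: "B \<in> sets M" "C \<in> sets M"
    unfolding C_def using A by (auto intro: sets_F_M)
  have BCA: "B \<union> C = A" "B \<inter> C = {}" by (auto simp: B_def C_def)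
  have "A \<subseteq> space M" using sets.sets_into_space[OF A] by (simp add: space_F)
  then have Bs: "\<And>\<omega>. \<omega> \<in> B \<Longrightarrow> X s \<omega> \<le> c" and Cs: "\<And>\<omega>. \<omega> \<in> C \<Longrightarrow> c \<le> X s \<omega>"
    by (auto simp: B_def C_def space_F)
  have split: "(\<integral>\<^sup>+\<omega>\<in>A. ennreal (min (X u \<omega>) c) \<partial>M) =
      (\<integral>\<^sup>+\<omega>\<in>B. ennreal (min (X u \<omega>) c) \<partial>M) + (\<integral>\<^sup>+\<omega>\<in>C. ennreal (min (X u \<omega>) c) \<partial>M)"
    if [measurable]: "X u \<in> borel_measurable M" for u
    unfolding BCA(1)[symmetric] by (rule nn_integral_disjoint_pair) (use BCA in auto)
  have "(\<integral>\<^sup>+\<omega>\<in>B. ennreal (min (X t \<omega>) c) \<partial>M) \<le> (\<integral>\<^sup>+\<omega>\<in>B. ennreal (X t \<omega>) \<partial>M)"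
    by (intro nn_integral_mono mult_right_mono ennreal_leI) auto
  also have "\<dots> = (\<integral>\<^sup>+\<omega>\<in>B. ennreal (X s \<omega>) \<partial>M)"
    by (rule mart[OF BF])
  also have "\<dots> = (\<integral>\<^sup>+\<omega>\<in>B. ennreal (min (X s \<omega>) c) \<partial>M)"
    by (intro nn_integral_cong) (auto simp: indicator_def Bs min_absorb1)
  finally have 1: "(\<integral>\<^sup>+\<omega>\<in>B. ennreal (min (X t \<omega>) c) \<partial>M) \<le> (\<integral>\<^sup>+\<omega>\<in>B. ennreal (min (X s \<omega>) c) \<partial>M)" .
  have 2: "(\<integral>\<^sup>+\<omega>\<in>C. ennreal (min (X t \<omega>) c) \<partial>M) \<le> (\<integral>\<^sup>+\<omega>\<in>C. ennreal (min (X s \<omega>) c) \<partial>M)"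
    by (intro nn_integral_mono) (auto simp: indicator_def Cs min_absorb2 intro!: ennreal_leI)
  show ?thesis
    unfolding split[OF X(1)] split[OF X(2)] by (rule add_mono[OF 1 2])
qed

lemma martingale_set_nn_integral:
  assumes mart: "martingale M {0..} F X" and st: "0 \<le> s" "s \<le> t" and A: "A \<in> sets (F s)"
  shows "(\<integral>\<^sup>+\<omega>\<in>A. ennreal (X t \<omega>) \<partial>M) = (\<integral>\<^sup>+\<omega>\<in>A. ennreal (X s \<omega>) \<partial>M)"
proof -
  have "\<forall>s\<in>{0..}. \<forall>t\<in>{0..}. s \<le> t \<longrightarrow> (\<forall>A\<in>sets (F s).
      (\<integral>\<^sup>+\<omega>\<in>A. ennreal (X t \<omega>) \<partial>M) = (\<integral>\<^sup>+\<omega>\<in>A. ennreal (X s \<omega>) \<partial>M))"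
  proof (rule iffD1[OF martingale_iff_set_nn_integral mart])
    show "integrable M (X t)" if "t \<in> {0..}" for t
      using mart that unfolding martingale_def by blast
    show "0 \<le> X t \<omega>" if "t \<in> {0..}" "\<omega> \<in> space M" for t \<omega>
      using pos[of t \<omega>] that by simp
  qed (simp_all add: filtration_axioms subalgebra_F adapted)
  from this[rule_format, of s t A] st A show ?thesis by simp
qed

text \<open>Fatou's lemma along a discretization of \<open>\<tau>\<close> gives \<open>\<le>\<close>. Conversely \<open>min X c\<close> is a bounded
  supermartingale, so bounded convergence and then \<open>c \<rightarrow> \<infinity>\<close> give \<open>\<ge>\<close>; this replaces
  uniform integrability.\<close>

lemma optional_sampling:
  assumes mart: "martingale M {0..} F X"
    and \<tau>: "stopping_time F \<tau>" and bounds: "\<And>\<omega>. 0 \<le> \<tau> \<omega>" "\<And>\<omega>. \<tau> \<omega> \<le> T" and T: "0 \<le> T"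
    and A: "A \<in> sets (pre_sigma \<tau>)"
  shows "(\<integral>\<^sup>+\<omega>\<in>A. ennreal (X (\<tau> \<omega>) \<omega>) \<partial>M) = (\<integral>\<^sup>+\<omega>\<in>A. ennreal (X T \<omega>) \<partial>M)"
proof -
  define d where "d k \<omega> = min T (real (nat \<lceil>real (Suc k) * \<tau> \<omega>\<rceil>) / real (Suc k))" for k \<omega>
  have step: "(\<integral>\<^sup>+\<omega>\<in>B. ennreal (X T \<omega>) \<partial>M) = (\<integral>\<^sup>+\<omega>\<in>B. ennreal (X s \<omega>) \<partial>M)"
    if "0 \<le> s" "s \<le> T" "B \<in> sets (F s)" for s B
    using martingale_set_nn_integral[OF mart that] .
  have A_M[measurable]: "A \<in> sets M"
    using subalgebra_pre_sigma[OF \<tau>] A by (auto simp: subalgebra_def)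
  have X_T[measurable]: "X T \<in> borel_measurable M"
    using adapted[OF T] by (rule measurable_F_M)
  have lim: "(\<lambda>k. X (d k \<omega>) \<omega>) \<longlonglongrightarrow> X (\<tau> \<omega>) \<omega>" if "\<omega> \<in> space M" for \<omega>
    unfolding d_def by (rule continuous_on_at_discretization[OF that bounds])
  have meas[measurable]: "(\<lambda>\<omega>. X (d k \<omega>) \<omega>) \<in> borel_measurable M" for k
    unfolding d_def by (rule set_nn_integral_discretization(1)[OF measurable_ident_sets[OF refl] \<tau> bounds T A])
  have level: "{\<omega>\<in>A. nat \<lceil>real (Suc k) * \<tau> \<omega>\<rceil> = i} \<in> sets (F (min T (real i / real (Suc k))))" for i k
    by (rule discretization_level_set[OF \<tau> bounds A]) simp
  show ?thesis
  proof (rule antisym)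
    show "(\<integral>\<^sup>+\<omega>\<in>A. ennreal (X (\<tau> \<omega>) \<omega>) \<partial>M) \<le> (\<integral>\<^sup>+\<omega>\<in>A. ennreal (X T \<omega>) \<partial>M)"
    proof (rule set_nn_integral_le_of_tendsto)
      show "AE \<omega> in M. (\<lambda>k. X (d k \<omega>) \<omega> * indicator A \<omega>) \<longlonglongrightarrow> X (\<tau> \<omega>) \<omega> * indicator A \<omega>"
        by (intro AE_I2 tendsto_mult lim tendsto_const)
      fix k
      \<comment> \<open>On each level set the rounded time is fixed and at most \<open>T\<close>, so
        the martingale identity applies term by term.\<close>
      show "(\<integral>\<^sup>+\<omega>\<in>A. ennreal (X (d k \<omega>) \<omega>) \<partial>M) \<le> (\<integral>\<^sup>+\<omega>\<in>A. ennreal (X T \<omega>) \<partial>M)"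
        unfolding d_def
          set_nn_integral_discretization(2,3)[where k=k, OF measurable_ident_sets[OF refl] \<tau> bounds T A]
        by (intro suminf_le summableI eq_refl[OF step[symmetric]] level) (use T in simp_all)
    qed measurable
    have trunc: "(\<integral>\<^sup>+\<omega>\<in>A. ennreal (min (X T \<omega>) c) \<partial>M) \<le> (\<integral>\<^sup>+\<omega>\<in>A. ennreal (X (\<tau> \<omega>) \<omega>) \<partial>M)" for c
    proof -
      have c[measurable]: "(\<lambda>x. min x c) \<in> borel_measurable borel" by measurable
      have "(\<lambda>k. \<integral>\<^sup>+\<omega>\<in>A. ennreal (min (X (d k \<omega>) \<omega>) c) \<partial>M) \<longlonglongrightarrow>
          (\<integral>\<^sup>+\<omega>\<in>A. ennreal (min (X (\<tau> \<omega>) \<omega>) c) \<partial>M)"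
      proof (rule nn_integral_dominated_convergence[where w="\<lambda>_. ennreal c"])
        have "(\<lambda>\<omega>. X (\<tau> \<omega>) \<omega>) \<in> borel_measurable M"
          by (rule borel_measurable_LIMSEQ_real[OF lim meas])
        then show "(\<lambda>\<omega>. ennreal (min (X (\<tau> \<omega>) \<omega>) c) * indicator A \<omega>) \<in> borel_measurable M"
          by measurable
        show "AE \<omega> in M. (\<lambda>k. ennreal (min (X (d k \<omega>) \<omega>) c) * indicator A \<omega>) \<longlonglongrightarrow>
            ennreal (min (X (\<tau> \<omega>) \<omega>) c) * indicator A \<omega>"
        proof (rule AE_I2)
          fix \<omega> assume "\<omega> \<in> space M"
          then have "(\<lambda>k. ennreal (min (X (d k \<omega>) \<omega>) c)) \<longlonglongrightarrow> ennreal (min (X (\<tau> \<omega>) \<omega>) c)"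
            by (intro tendsto_ennrealI tendsto_min lim tendsto_const)
          then show "(\<lambda>k. ennreal (min (X (d k \<omega>) \<omega>) c) * indicator A \<omega>) \<longlonglongrightarrow>
              ennreal (min (X (\<tau> \<omega>) \<omega>) c) * indicator A \<omega>"
            by (cases "\<omega> \<in> A") simp_all
        qed
      qed (auto simp: emeasure_space_1 ennreal_mult_less_top indicator_def intro!: AE_I2 ennreal_leI)
      moreover have "(\<integral>\<^sup>+\<omega>\<in>A. ennreal (min (X T \<omega>) c) \<partial>M) \<le>
          (\<integral>\<^sup>+\<omega>\<in>A. ennreal (min (X (d k \<omega>) \<omega>) c) \<partial>M)" for k
        unfolding d_def set_nn_integral_discretization(2,3)[where k=k, OF c \<tau> bounds T A]
        by (intro suminf_le summableI set_nn_integral_truncation_le step level) (use T in simp_all)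
      ultimately have "(\<integral>\<^sup>+\<omega>\<in>A. ennreal (min (X T \<omega>) c) \<partial>M) \<le>
          (\<integral>\<^sup>+\<omega>\<in>A. ennreal (min (X (\<tau> \<omega>) \<omega>) c) \<partial>M)"
        by (intro LIMSEQ_le_const) auto
      also have "\<dots> \<le> (\<integral>\<^sup>+\<omega>\<in>A. ennreal (X (\<tau> \<omega>) \<omega>) \<partial>M)"
        by (intro nn_integral_mono mult_right_mono ennreal_leI) auto
      finally show ?thesis .
    qed
    show "(\<integral>\<^sup>+\<omega>\<in>A. ennreal (X T \<omega>) \<partial>M) \<le> (\<integral>\<^sup>+\<omega>\<in>A. ennreal (X (\<tau> \<omega>) \<omega>) \<partial>M)"
    proof (rule set_nn_integral_le_of_tendsto[where f="\<lambda>n \<omega>. min (X T \<omega>) (real n)"])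
      show "AE \<omega> in M. (\<lambda>n. min (X T \<omega>) (real n) * indicator A \<omega>) \<longlonglongrightarrow> X T \<omega> * indicator A \<omega>"
      proof (intro AE_I2 tendsto_mult tendsto_const tendsto_eventually)
        fix \<omega>
        have "\<forall>\<^sub>F n in sequentially. X T \<omega> \<le> real n"
          using filterlim_real_sequentially by (simp add: filterlim_at_top)
        then show "\<forall>\<^sub>F n in sequentially. min (X T \<omega>) (real n) = X T \<omega>"
          by eventually_elim simp
      qed
    qed (use trunc in measurable)
  qed
qed

end

section \<open>Positive continuous local martingales\<close>

lemma stopped_process_eq:
  assumes "0 \<le> t" "ennreal t \<le> \<sigma> \<omega>"
  shows "stopped_process X \<sigma> t \<omega> = X t \<omega>"
  using assms by (simp add: stopped_process_def min_absorb1)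

lemma stopped_process_0: "stopped_process X \<sigma> 0 = X 0"
  by (rule ext) (simp add: stopped_process_def)

text \<open>Stopping composes a path with this clock, so stopped paths inherit continuity.\<close>

lemma continuous_on_stopped_clock: "continuous_on {0..} (\<lambda>t. enn2real (min (ennreal t) s))"
proof (cases s)
  case (real r)
  have "continuous_on {0..} (\<lambda>t. min t r)"
    by (intro continuous_intros)
  then show ?thesis
    by (rule continuous_on_eq) (use real in \<open>simp add: min_def ennreal_le_iff\<close>)
next
  case top
  have "continuous_on {0..} (\<lambda>t::real. t)"
    by (rule continuous_on_id)
  then show ?thesis
    by (rule continuous_on_eq) (simp add: top min_absorb1)
qed

context continuous_process
begin

text \<open>Makes optional sampling available for the stopped processes. Adaptedness comes from the
  martingale hypothesis, continuity and positivity from \<open>X\<close>.\<close>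

lemma continuous_process_stopped:
  assumes "martingale M {0..} F (stopped_process X \<sigma>)"
  shows "continuous_process M F (stopped_process X \<sigma>)"
proof unfold_locales
  show "stopped_process X \<sigma> t \<in> borel_measurable (F t)" if "0 \<le> t" for t
    using assms that unfolding martingale_def by simp
  show "continuous_on {0..} (\<lambda>t. stopped_process X \<sigma> t \<omega>)" if "\<omega> \<in> space M" for \<omega>
    unfolding stopped_process_def
    by (rule continuous_on_compose2[OF continuous[OF that] continuous_on_stopped_clock]) auto
  show "0 < stopped_process X \<sigma> t \<omega>" if "0 \<le> t" "\<omega> \<in> space M" for t \<omega>
    unfolding stopped_process_def using that by (intro pos) auto
qed

text \<open>In this form of divergence, the stopped process almost surely agrees with
  \<open>X\<close> at any given time for all large \<open>n\<close>.\<close>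

lemma localizing_sequence:
  assumes "local_martingale M F X"
  obtains \<sigma> :: "nat \<Rightarrow> 'a \<Rightarrow> ennreal"
  where "\<And>n. ext_stopping_time F (\<sigma> n)"
    and "\<And>n. martingale M {0..} F (stopped_process X (\<sigma> n))"
    and "AE \<omega> in M. \<forall>t. \<forall>\<^sub>F n in sequentially. ennreal t < \<sigma> n \<omega>"
proof -
  from assms obtain \<sigma> where \<sigma>: "\<And>n. ext_stopping_time F (\<sigma> n)"
      "AE \<omega> in M. incseq (\<lambda>n. \<sigma> n \<omega>) \<and> (\<lambda>n. \<sigma> n \<omega>) \<longlonglongrightarrow> \<infinity>"
      "\<And>n. martingale M {0..} F (stopped_process X (\<sigma> n))"
    unfolding local_martingale_def by blast
  have "AE \<omega> in M. \<forall>t. \<forall>\<^sub>F n in sequentially. ennreal t < \<sigma> n \<omega>"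
    using \<sigma>(2) by eventually_elim (auto intro: order_tendstoD(1))
  with \<sigma> show thesis by (intro that)
qed

text \<open>Fatou's lemma along the localizing sequence, applied to events on which stopping has not
  yet taken effect at time \<open>s\<close>.\<close>

lemma local_martingale_set_nn_integral_le:
  assumes lm: "local_martingale M F X" and st: "0 \<le> s" "s \<le> t" and A: "A \<in> sets (F s)"
  shows "(\<integral>\<^sup>+\<omega>\<in>A. ennreal (X t \<omega>) \<partial>M) \<le> (\<integral>\<^sup>+\<omega>\<in>A. ennreal (X s \<omega>) \<partial>M)"
proof -
  from localizing_sequence[OF lm] obtain \<sigma> where \<sigma>: "\<And>n. ext_stopping_time F (\<sigma> n)"
      "\<And>n. martingale M {0..} F (stopped_process X (\<sigma> n))"
      "AE \<omega> in M. \<forall>t. \<forall>\<^sub>F n in sequentially. ennreal t < \<sigma> n \<omega>"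
    by metis
  \<comment> \<open>Where \<open>\<sigma> n\<close> exceeds \<open>s\<close>, the stopped process at
    \<open>s\<close> is \<open>X s\<close>. These parts of \<open>A\<close> lie in
    \<open>F s\<close> and exhaust \<open>A\<close> up to a null set.\<close>
  define B where "B n = A - {\<omega> \<in> space (F s). \<sigma> n \<omega> \<le> ennreal s}" for n
  have B: "B n \<in> sets (F s)" for n
    unfolding B_def using A \<sigma>(1)[of n] st by (auto simp: ext_stopping_time_def pred_def)
  have A_space: "A \<subseteq> space M" using sets.sets_into_space[OF A] by (simp add: space_F)
  show ?thesis
  proof (rule set_nn_integral_le_of_tendsto)
    show "stopped_process X (\<sigma> n) t \<in> borel_measurable M" for n
      using continuous_process.adapted[OF continuous_process_stopped[OF \<sigma>(2)], of t n] st
      by (auto intro: measurable_F_M)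
    show "B n \<in> sets M" for n
      by (rule sets_F_M[OF B])
    show "AE \<omega> in M. (\<lambda>n. stopped_process X (\<sigma> n) t \<omega> * indicator (B n) \<omega>)
        \<longlonglongrightarrow> X t \<omega> * indicator A \<omega>"
      using \<sigma>(3)
    proof eventually_elim
      fix \<omega> assume "\<forall>t. \<forall>\<^sub>F n in sequentially. ennreal t < \<sigma> n \<omega>"
      then have "\<forall>\<^sub>F n in sequentially. ennreal t < \<sigma> n \<omega>" by blast
      then have "\<forall>\<^sub>F n in sequentially. stopped_process X (\<sigma> n) t \<omega> * indicator (B n) \<omega> = X t \<omega> * indicator A \<omega>"
      proof eventually_elim
        fix n assume n: "ennreal t < \<sigma> n \<omega>"
        then have "ennreal s < \<sigma> n \<omega>"
          using st by (meson ennreal_leI le_less_trans)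
        then have "indicator (B n) \<omega> = (indicator A \<omega> :: real)"
          by (auto simp: B_def indicator_def)
        with n st show "stopped_process X (\<sigma> n) t \<omega> * indicator (B n) \<omega> = X t \<omega> * indicator A \<omega>"
          by (simp add: stopped_process_eq less_imp_le)
      qed
      then show "(\<lambda>n. stopped_process X (\<sigma> n) t \<omega> * indicator (B n) \<omega>)
        \<longlonglongrightarrow> X t \<omega> * indicator A \<omega>"
        by (rule tendsto_eventually)
    qed
    fix n
    have "(\<integral>\<^sup>+\<omega>\<in>B n. ennreal (stopped_process X (\<sigma> n) t \<omega>) \<partial>M) =
        (\<integral>\<^sup>+\<omega>\<in>B n. ennreal (stopped_process X (\<sigma> n) s \<omega>) \<partial>M)"
      by (rule continuous_process.martingale_set_nn_integral
          [OF continuous_process_stopped[OF \<sigma>(2)] \<sigma>(2) st B])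
    also have "\<dots> = (\<integral>\<^sup>+\<omega>\<in>B n. ennreal (X s \<omega>) \<partial>M)"
    proof (intro nn_integral_cong)
      fix \<omega> assume "\<omega> \<in> space M"
      then show "ennreal (stopped_process X (\<sigma> n) s \<omega>) * indicator (B n) \<omega> =
          ennreal (X s \<omega>) * indicator (B n) \<omega>"
        using st by (auto simp: B_def indicator_def stopped_process_eq space_F)
    qed
    also have "\<dots> \<le> (\<integral>\<^sup>+\<omega>\<in>A. ennreal (X s \<omega>) \<partial>M)"
      by (intro nn_integral_mono) (auto simp: B_def indicator_def)
    finally show "(\<integral>\<^sup>+\<omega>\<in>B n. ennreal (stopped_process X (\<sigma> n) t \<omega>) \<partial>M) \<le>
        (\<integral>\<^sup>+\<omega>\<in>A. ennreal (X s \<omega>) \<partial>M)" .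
  qed
qed

lemma local_martingale_nn_integral_le:
  assumes "local_martingale M F X" "0 \<le> s" "s \<le> t"
  shows "(\<integral>\<^sup>+\<omega>. ennreal (X t \<omega>) \<partial>M) \<le> (\<integral>\<^sup>+\<omega>. ennreal (X s \<omega>) \<partial>M)"
proof -
  have eq: "(\<integral>\<^sup>+\<omega>. f \<omega> \<partial>M) = (\<integral>\<^sup>+\<omega>\<in>space (F s). f \<omega> \<partial>M)" for f :: "'a \<Rightarrow> ennreal"
    by (intro nn_integral_cong) (simp add: space_F)
  show ?thesis
    using local_martingale_set_nn_integral_le[OF assms sets.top] by (simp only: eq[symmetric])
qed

text \<open>At time 0 every stopped process is \<open>X 0\<close>, so a single localizing martingale
  gives integrability there; nonincreasing expectation transfers it to \<open>t\<close>.\<close>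

lemma local_martingale_integrable:
  assumes lm: "local_martingale M F X" and t: "0 \<le> t"
  shows "integrable M (X t)"
proof -
  from localizing_sequence[OF lm] obtain \<sigma> where
      "\<And>n::nat. martingale M {0..} F (stopped_process X (\<sigma> n))"
    by metis
  then have "integrable M (stopped_process X (\<sigma> 0) 0)"
    unfolding martingale_def by simp
  then have int0: "integrable M (X 0)"
    by (simp add: stopped_process_0)
  have "(\<integral>\<^sup>+\<omega>. ennreal (X t \<omega>) \<partial>M) \<le> (\<integral>\<^sup>+\<omega>. ennreal (X 0 \<omega>) \<partial>M)"
    by (rule local_martingale_nn_integral_le[OF lm _ t]) simp
  also have "\<dots> < \<infinity>"
    using nn_integral_eq_integral[OF int0] pos[of 0] by (auto simp: less_imp_le intro!: AE_I2)
  finally show ?thesis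
    using pos[OF t] measurable_F_M[OF adapted[OF t]]
    by (auto simp: less_imp_le intro!: integrableI_nonneg AE_I2)
qed

text \<open>A positive local martingale is a supermartingale, so it is a martingale as soon as its
  expectation is constant.\<close>

lemma strict_local_martingale_expectation_drop:
  assumes "strict_local_martingale M F X"
  shows "\<exists>T\<ge>0. (\<integral>\<^sup>+\<omega>. ennreal (X T \<omega>) \<partial>M) < (\<integral>\<^sup>+\<omega>. ennreal (X 0 \<omega>) \<partial>M)"
proof (rule ccontr)
  assume not_less: "\<not> ?thesis"
  have lm: "local_martingale M F X" and strict: "\<not> martingale M {0..} F X"
    using assms by (auto simp: strict_local_martingale_def)
  have const: "(\<integral>\<^sup>+\<omega>. ennreal (X t \<omega>) \<partial>M) = (\<integral>\<^sup>+\<omega>. ennreal (X 0 \<omega>) \<partial>M)" if "0 \<le> t" for t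
    using local_martingale_nn_integral_le[OF lm order_refl that] not_less that
    by (meson antisym_conv1)
  have "martingale M {0..} F X"
  proof (subst martingale_iff_set_nn_integral, goal_cases)
    case 6
    show ?case
    proof (intro ballI impI)
      fix s t A assume "s \<in> {0::real..}" "t \<in> {0::real..}" and st: "s \<le> t" and A: "A \<in> sets (F s)"
      then have s: "0 \<le> s" and t: "0 \<le> t" by auto
      \<comment> \<open>The supermartingale inequality holds on \<open>A\<close> and on its
        complement, while the totals agree. The integral over \<open>B\<close> at time
        \<open>s\<close> is finite, so cancelling it forces equality on \<open>A\<close>.\<close>
      define B where "B = space M - A"
      have B: "B \<in> sets (F s)" using A by (auto simp: B_def space_F[of s, symmetric])
      have split: "(\<integral>\<^sup>+\<omega>. ennreal (X u \<omega>) \<partial>M) =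
          (\<integral>\<^sup>+\<omega>\<in>A. ennreal (X u \<omega>) \<partial>M) + (\<integral>\<^sup>+\<omega>\<in>B. ennreal (X u \<omega>) \<partial>M)" if "0 \<le> u" for u
        unfolding B_def
        by (rule nn_integral_split_complement[OF _ sets_F_M[OF A]])
           (use measurable_F_M[OF adapted[OF that]] in measurable)
      have fin: "(\<integral>\<^sup>+\<omega>\<in>B. ennreal (X s \<omega>) \<partial>M) \<noteq> \<infinity>"
        using set_nn_integral_eq_set_integral[OF local_martingale_integrable[OF lm s] _ sets_F_M[OF B]] pos[OF s]
        by (simp add: less_imp_le)
      have "(\<integral>\<^sup>+\<omega>\<in>A. ennreal (X s \<omega>) \<partial>M) + (\<integral>\<^sup>+\<omega>\<in>B. ennreal (X s \<omega>) \<partial>M) =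
          (\<integral>\<^sup>+\<omega>\<in>A. ennreal (X t \<omega>) \<partial>M) + (\<integral>\<^sup>+\<omega>\<in>B. ennreal (X t \<omega>) \<partial>M)"
        unfolding split[OF s, symmetric] split[OF t, symmetric] const[OF s] const[OF t] ..
      also have "\<dots> \<le> (\<integral>\<^sup>+\<omega>\<in>A. ennreal (X t \<omega>) \<partial>M) + (\<integral>\<^sup>+\<omega>\<in>B. ennreal (X s \<omega>) \<partial>M)"
        by (intro add_left_mono local_martingale_set_nn_integral_le lm s st B)
      finally have "(\<integral>\<^sup>+\<omega>\<in>A. ennreal (X s \<omega>) \<partial>M) \<le> (\<integral>\<^sup>+\<omega>\<in>A. ennreal (X t \<omega>) \<partial>M)"
        using fin by (simp add: add.commute ennreal_add_left_cancel_le)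
      with local_martingale_set_nn_integral_le[OF lm s st A]
      show "(\<integral>\<^sup>+\<omega>\<in>A. ennreal (X t \<omega>) \<partial>M) = (\<integral>\<^sup>+\<omega>\<in>A. ennreal (X s \<omega>) \<partial>M)"
        by (rule antisym)
    qed
  qed (use pos in \<open>auto simp: filtration_axioms subalgebra_F adapted less_imp_le
      intro: local_martingale_integrable[OF lm]\<close>)
  with strict show False by contradiction
qed

text \<open>Up to a hitting time the process is dominated by \<open>max (X 0) b\<close>, so the localizing sequence can
  be removed by dominated convergence.\<close>

lemma set_nn_integral_hit_eq:
  assumes lm: "local_martingale M F X" and c: "0 \<le> c" "c \<le> c'" "b \<le> b'"
    and A: "A \<in> sets (pre_sigma (hit X b c))"
  shows "(\<integral>\<^sup>+\<omega>\<in>A. ennreal (X (hit X b c \<omega>) \<omega>) \<partial>M) =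
    (\<integral>\<^sup>+\<omega>\<in>A. ennreal (X (hit X b' c' \<omega>) \<omega>) \<partial>M)"
proof -
  from localizing_sequence[OF lm] obtain \<sigma> where
      \<sigma>: "\<And>n. martingale M {0..} F (stopped_process X (\<sigma> n))"
      "AE \<omega> in M. \<forall>t. \<forall>\<^sub>F n::nat in sequentially. ennreal t < \<sigma> n \<omega>"
    by metis
  define Y where "Y n = stopped_process X (\<sigma> n)" for n
  have Y: "continuous_process M F (Y n)" for n
    unfolding Y_def by (rule continuous_process_stopped[OF \<sigma>(1)])
  have c': "0 \<le> c'" using c by simp
  have A_M: "A \<in> sets M"
    using subalgebra_pre_sigma[OF stopping_time_hit[OF c(1)]] A by (auto simp: subalgebra_def)
  \<comment> \<open>As \<open>A\<close> also belongs to the past of the later time, both sampled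
    integrals can be compared with the value at the common bound \<open>c'\<close>.\<close>
  have "A \<in> sets (pre_sigma (hit X b' c'))"
    using mono_pre_sigma[OF stopping_time_hit[OF c(1)] stopping_time_hit[OF c'] hit_mono] continuous c A
    by blast
  note A' = A this
  have sample: "(\<integral>\<^sup>+\<omega>\<in>A. ennreal (Y n (hit X \<beta> \<gamma> \<omega>) \<omega>) \<partial>M) = (\<integral>\<^sup>+\<omega>\<in>A. ennreal (Y n c' \<omega>) \<partial>M)"
    if "0 \<le> \<gamma>" "\<gamma> \<le> c'" "A \<in> sets (pre_sigma (hit X \<beta> \<gamma>))" for n \<beta> \<gamma>
  proof (rule continuous_process.optional_sampling[OF Y])
    show "hit X \<beta> \<gamma> \<omega> \<le> c'" for \<omega>
      using hit_le[OF that(1), of X \<beta> \<omega>] that(2) by simp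
  qed (use that c' \<sigma>(1) stopping_time_hit[OF that(1)] in \<open>auto simp: Y_def hit_nonneg\<close>)
  have lim: "(\<lambda>n. \<integral>\<^sup>+\<omega>\<in>A. ennreal (Y n (hit X \<beta> \<gamma> \<omega>) \<omega>) \<partial>M) \<longlonglongrightarrow>
      (\<integral>\<^sup>+\<omega>\<in>A. ennreal (X (hit X \<beta> \<gamma> \<omega>) \<omega>) \<partial>M)" if "0 \<le> \<gamma>" for \<beta> \<gamma>
  proof (rule nn_integral_dominated_convergence[where w="\<lambda>\<omega>. ennreal (X 0 \<omega> + \<bar>\<beta>\<bar>)"])
    note hit = stopping_time_hit[OF that, of \<beta>]
    have X0: "integrable M (X 0)"
      by (rule local_martingale_integrable[OF lm order_refl])
    have "(\<lambda>\<omega>. Z (hit X \<beta> \<gamma> \<omega>) \<omega>) \<in> borel_measurable M" if "continuous_process M F Z" for Z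
      by (rule measurable_from_subalg[OF subalgebra_pre_sigma[OF hit]
          continuous_process.measurable_at_stopping_time[OF that hit hit_nonneg]])
    from this[OF Y] this[OF continuous_process_axioms] A_M
    show "(\<lambda>\<omega>. ennreal (Y n (hit X \<beta> \<gamma> \<omega>) \<omega>) * indicator A \<omega>) \<in> borel_measurable M"
      "(\<lambda>\<omega>. ennreal (X (hit X \<beta> \<gamma> \<omega>) \<omega>) * indicator A \<omega>) \<in> borel_measurable M" for n
      by measurable
    show "(\<lambda>\<omega>. ennreal (X 0 \<omega> + \<bar>\<beta>\<bar>)) \<in> borel_measurable M"
      using X0 by measurable
    show "(\<integral>\<^sup>+\<omega>. ennreal (X 0 \<omega> + \<bar>\<beta>\<bar>) \<partial>M) < \<infinity>"
      using X0 pos[of 0]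
      by (subst nn_integral_eq_integral) (auto intro!: AE_I2 add_nonneg_nonneg simp: less_imp_le)
    show "AE \<omega> in M. ennreal (Y n (hit X \<beta> \<gamma> \<omega>) \<omega>) * indicator A \<omega> \<le> ennreal (X 0 \<omega> + \<bar>\<beta>\<bar>)" for n
    proof (rule AE_I2)
      fix \<omega> assume \<omega>: "\<omega> \<in> space M"
      \<comment> \<open>The clock stopped at \<open>\<sigma> n\<close> never passes the hitting
        time, so one bound serves all the stopped processes.\<close>
      let ?u = "enn2real (min (ennreal (hit X \<beta> \<gamma> \<omega>)) (\<sigma> n \<omega>))"
      have "?u \<le> hit X \<beta> \<gamma> \<omega>"
        by (rule enn2real_leI) (auto simp: hit_nonneg)
      then have "Y n (hit X \<beta> \<gamma> \<omega>) \<omega> \<le> max (X 0 \<omega>) \<beta>"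
        unfolding Y_def stopped_process_def by (intro le_hit_bound continuous \<omega>) auto
      also have "\<dots> \<le> X 0 \<omega> + \<bar>\<beta>\<bar>"
        using pos[OF order_refl \<omega>] by auto
      finally show "ennreal (Y n (hit X \<beta> \<gamma> \<omega>) \<omega>) * indicator A \<omega> \<le> ennreal (X 0 \<omega> + \<bar>\<beta>\<bar>)"
        by (auto simp: indicator_def intro: ennreal_leI)
    qed
    show "AE \<omega> in M. (\<lambda>n. ennreal (Y n (hit X \<beta> \<gamma> \<omega>) \<omega>) * indicator A \<omega>) \<longlonglongrightarrow>
        ennreal (X (hit X \<beta> \<gamma> \<omega>) \<omega>) * indicator A \<omega>"
      using \<sigma>(2)
    proof eventually_elim
      fix \<omega> assume "\<forall>t. \<forall>\<^sub>F n in sequentially. ennreal t < \<sigma> n \<omega>"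
      then have "\<forall>\<^sub>F n in sequentially. ennreal (hit X \<beta> \<gamma> \<omega>) < \<sigma> n \<omega>" by blast
      then have "\<forall>\<^sub>F n in sequentially. ennreal (Y n (hit X \<beta> \<gamma> \<omega>) \<omega>) * indicator A \<omega> =
          ennreal (X (hit X \<beta> \<gamma> \<omega>) \<omega>) * indicator A \<omega>"
        by eventually_elim (simp add: Y_def stopped_process_eq hit_nonneg less_imp_le)
      then show "(\<lambda>n. ennreal (Y n (hit X \<beta> \<gamma> \<omega>) \<omega>) * indicator A \<omega>) \<longlonglongrightarrow>
          ennreal (X (hit X \<beta> \<gamma> \<omega>) \<omega>) * indicator A \<omega>"
        by (rule tendsto_eventually)
    qed
  qed
  have "(\<lambda>n. \<integral>\<^sup>+\<omega>\<in>A. ennreal (Y n (hit X b c \<omega>) \<omega>) \<partial>M) =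
      (\<lambda>n. \<integral>\<^sup>+\<omega>\<in>A. ennreal (Y n (hit X b' c' \<omega>) \<omega>) \<partial>M)"
    by (simp only: sample[OF c(1,2) A'(1)] sample[OF c' order_refl A'(2)])
  with lim[OF c(1), of b] lim[OF c', of b'] show ?thesis
    by (simp only: LIMSEQ_unique)
qed

end

section \<open>Drop times\<close>

text \<open>\<open>enat\<close> is well-ordered, so the infimum of a nonempty set of drop indices is
  itself such an index. This reduces drop times to finite searches.\<close>

lemma drop_time_Suc_le_iff:
  "drop_time S (Suc k) \<omega> \<le> enat i \<longleftrightarrow> (\<exists>j\<le>i. drop_time S k \<omega> < enat j \<and> S j \<omega> < S (j - 1) \<omega>)"
  (is "?L \<longleftrightarrow> ?R")
proof
  let ?D = "{enat j |j. drop_time S k \<omega> < enat j \<and> S j \<omega> < S (j - 1) \<omega>}"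
  assume L: ?L
  then have "?D \<noteq> {}"
    by (auto simp: Inf_enat_def split: if_splits)
  then have "Inf ?D \<in> ?D"
    by (meson ex_in_conv wellorder_InfI)
  with L show ?R by auto
next
  assume ?R
  then obtain j where j: "j \<le> i" "drop_time S k \<omega> < enat j" "S j \<omega> < S (j - 1) \<omega>" by blast
  then have "drop_time S (Suc k) \<omega> \<le> enat j"
    by (auto intro!: Inf_lower)
  also have "enat j \<le> enat i" using j by simp
  finally show ?L .
qed

lemma drop_time_Suc_eq_enat:
  assumes "drop_time S (Suc k) \<omega> = enat i"
  shows "S i \<omega> < S (i - 1) \<omega>"
proof -
  obtain j where j: "j \<le> i" "drop_time S k \<omega> < enat j" "S j \<omega> < S (j - 1) \<omega>"
    using drop_time_Suc_le_iff[of S k \<omega> i] assms by auto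
  then have "drop_time S (Suc k) \<omega> \<le> enat j"
    using drop_time_Suc_le_iff[of S k \<omega> j] by blast
  with assms j show ?thesis by (simp del: drop_time.simps)
qed

text \<open>Each drop index lies strictly beyond the previous one. Thus the \<open>N\<close>-th drop
  can only occur at an index whose horizon already exceeds \<open>T\<close>.\<close>

lemma le_drop_time: "enat k \<le> drop_time S k \<omega>"
proof (induction k)
  case 0
  then show ?case by (simp add: zero_enat_def)
next
  case (Suc k)
  show ?case
    unfolding drop_time.simps
  proof (rule Inf_greatest, clarify)
    fix j assume "drop_time S k \<omega> < enat j"
    with Suc have "enat k < enat j" by (rule le_less_trans)
    then show "enat (Suc k) \<le> enat j" by simp
  qed
qed

text \<open>Going back from \<open>k\<close>, some drop time is finite, as the one of index 0 is 0;
  after the last finite one no drop occurs.\<close>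

lemma drop_time_infinity_mono:
  assumes "drop_time S k \<omega> = \<infinity>"
  shows "\<exists>N. \<forall>n\<ge>N. S n \<omega> \<le> S (Suc n) \<omega>"
  using assms
proof (induction k)
  case 0
  then show ?case by simp
next
  case (Suc k)
  show ?case
  proof (cases "drop_time S k \<omega>")
    case (enat m)
    have "S n \<omega> \<le> S (Suc n) \<omega>" if "m \<le> n" for n
    proof (rule ccontr)
      assume "\<not> ?thesis"
      with that enat have "drop_time S (Suc k) \<omega> \<le> enat (Suc n)"
        unfolding drop_time_Suc_le_iff by (intro exI[of _ "Suc n"]) auto
      with Suc.prems show False by simp
    qed
    then show ?thesis by blast
  qed (rule Suc.IH)
qed

lemma drop_time_measurable:
  fixes G :: "nat \<Rightarrow> 'a measure"
  assumes "filtration \<Omega> G" and S: "\<And>n. S n \<in> borel_measurable (G n)"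
  shows "Measurable.pred (G i) (\<lambda>\<omega>. drop_time S k \<omega> \<le> enat i)"
proof -
  interpret filtration \<Omega> G by fact
  have mono: "f \<in> borel_measurable (G m) \<Longrightarrow> f \<in> borel_measurable (G n)" if "m \<le> n" for m n and f :: "'a \<Rightarrow> real"
    using sets_F_mono[OF that] by (auto simp: measurable_def space_F)
  have mono_pred: "Measurable.pred (G m) P \<Longrightarrow> Measurable.pred (G n) P" if "m \<le> n" for m n P
    using sets_F_mono[OF that] by (auto simp: pred_def space_F)
  show ?thesis
  proof (induction k arbitrary: i)
    case 0
    then show ?case by (simp add: zero_enat_def)
  next
    case (Suc k)
    \<comment> \<open>The strict inequality is an event of index \<open>j - 1\<close>, to which the
      induction hypothesis applies; \<open>j = 0\<close> is separate because
      \<open>0 - 1 = 0\<close> on \<open>nat\<close>.\<close>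
    have less: "drop_time S k \<omega> < enat j \<longleftrightarrow> j \<noteq> 0 \<and> drop_time S k \<omega> \<le> enat (j - 1)" for j \<omega>
      by (cases "drop_time S k \<omega>"; cases j) auto
    have "Measurable.pred (G i) (\<lambda>\<omega>. drop_time S k \<omega> < enat j \<and> S j \<omega> < S (j - 1) \<omega>)" if "j \<le> i" for j
    proof -
      have [measurable]: "S j \<in> borel_measurable (G i)" "S (j - 1) \<in> borel_measurable (G i)"
        using that by (auto intro: mono[OF _ S])
      have [measurable]: "Measurable.pred (G i) (\<lambda>\<omega>. drop_time S k \<omega> \<le> enat (j - 1))"
        by (rule mono_pred[OF _ Suc.IH]) (use that in simp)
      show ?thesis unfolding less by measurable
    qed
    then have "Measurable.pred (G i) (\<lambda>\<omega>. \<exists>j\<in>{..i}. drop_time S k \<omega> < enat j \<and> S j \<omega> < S (j - 1) \<omega>)"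
      by (intro pred_intros_finite) auto
    then show ?case
      by (simp only: drop_time_Suc_le_iff Bex_def atMost_iff)
  qed
qed

text \<open>A finite liminf bounds a nondecreasing tail: once above a larger bound, the tail would
  stay there and raise the liminf. Bounded monotone sequences converge.\<close>

lemma LIMSEQ_of_eventually_mono:
  fixes u :: "nat \<Rightarrow> real"
  assumes mono: "\<And>n. N \<le> n \<Longrightarrow> u n \<le> u (Suc n)" and fin: "liminf (\<lambda>n. ennreal (u n)) < \<infinity>"
  shows "u \<longlonglongrightarrow> lim u"
proof -
  obtain r where r: "liminf (\<lambda>n. ennreal (u n)) = ennreal r" "0 \<le> r"
    using fin by (cases "liminf (\<lambda>n. ennreal (u n))") auto
  define B where "B = r + 1"
  have B: "liminf (\<lambda>n. ennreal (u n)) < ennreal B"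
    using r by (simp add: B_def ennreal_less_iff)
  have inc: "incseq (\<lambda>n. u (n + N))"
    by (rule incseq_SucI) (use mono in simp)
  have "u (n + N) \<le> B" for n
  proof (rule ccontr)
    assume *: "\<not> u (n + N) \<le> B"
    have "\<forall>\<^sub>F m in sequentially. ennreal B \<le> ennreal (u m)"
      unfolding eventually_sequentially
    proof (intro exI allI impI ennreal_leI)
      fix m assume "n + N \<le> m"
      then have "u (n + N) \<le> u (m - N + N)"
        by (intro incseqD[OF inc]) simp
      with * \<open>n + N \<le> m\<close> show "B \<le> u m" by simp
    qed
    then have "ennreal B \<le> liminf (\<lambda>n. ennreal (u n))"
      by (rule Liminf_bounded)
    with B show False by simp
  qed
  then obtain L where "(\<lambda>n. u (n + N)) \<longlonglongrightarrow> L"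
    using incseq_convergent[OF inc, of B] by blast
  then have "convergent (\<lambda>n. u (n + N))"
    by (rule convergentI)
  then have "convergent u"
    by (simp add: convergent_ignore_initial_segment)
  then show ?thesis by (simp add: convergent_LIMSEQ_iff)
qed

text \<open>If the times differed, the horizon \<open>c\<close> would give a time below
  \<open>c\<close> at which the level is reached, yet which precedes the hitting time for
  \<open>c'\<close>.\<close>

lemma hit_eq_hit:
  assumes "continuous_on {0..} (\<lambda>t. X t \<omega>)" "0 \<le> c" "c \<le> c'" "hit X b c' \<omega> \<le> c"
  shows "hit X b c' \<omega> = hit X b c \<omega>"
proof (rule ccontr)
  assume "hit X b c' \<omega> \<noteq> hit X b c \<omega>"
  then have *: "hit X b c \<omega> < hit X b c' \<omega>"
    using hit_mono[of X \<omega> c c' b b, OF assms(1,2,3)] by simp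
  then have "b \<le> X (hit X b c \<omega>) \<omega>"
    using hit_less_bound[of X \<omega> c b, OF assms(1,2)] assms(4) by simp
  moreover have "X (hit X b c \<omega>) \<omega> < b"
    by (rule less_hit[OF hit_nonneg *])
  ultimately show False by simp
qed

text \<open>Optional stopping at a bounded discrete time, by induction on \<open>n\<close>: on the
  event that the drop has occurred by \<open>n\<close> the value is frozen, and the complement lies
  in \<open>G n\<close>, where one martingale step applies. The minimum is finite, so
  \<open>the_enat\<close> is exact.\<close>

lemma nn_integral_stopped_at_drop_time:
  fixes G :: "nat \<Rightarrow> 'a measure" and k :: nat
  assumes G: "filtration (space M) G" and sub: "\<And>n. subalgebra M (G n)"
    and S: "\<And>n. S n \<in> borel_measurable (G n)"
    and mart: "\<And>n A. A \<in> sets (G n) \<Longrightarrow>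
      (\<integral>\<^sup>+\<omega>\<in>A. ennreal (S (Suc n) \<omega>) \<partial>M) = (\<integral>\<^sup>+\<omega>\<in>A. ennreal (S n \<omega>) \<partial>M)"
  defines "V \<equiv> \<lambda>n \<omega>. S (the_enat (min (drop_time S k \<omega>) (enat n))) \<omega>"
  shows "V n \<in> borel_measurable M \<and> (\<integral>\<^sup>+\<omega>. ennreal (V n \<omega>) \<partial>M) = (\<integral>\<^sup>+\<omega>. ennreal (S 0 \<omega>) \<partial>M)"
proof (induction n)
  have S_M[measurable]: "S n \<in> borel_measurable M" for n
    by (rule measurable_from_subalg[OF sub S])
  case 0
  have "min x (enat 0) = enat 0" for x
    by (cases x) simp_all
  then have "V 0 = S 0"
    unfolding V_def by (simp only: the_enat.simps)
  then show ?case by simp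
next
  have S_M[measurable]: "S n \<in> borel_measurable M" for n
    by (rule measurable_from_subalg[OF sub S])
  case (Suc n)
  then have V_M[measurable]: "V n \<in> borel_measurable M" by simp
  define A where "A = {\<omega> \<in> space M. drop_time S k \<omega> \<le> enat n}"
  define B where "B = space M - A"
  have "A \<in> sets (G n)"
    using drop_time_measurable[OF G, where S=S and i=n and k=k, OF S] by (simp add: A_def pred_def filtration.space_F[OF G])
  then have AB_G: "A \<in> sets (G n)" "B \<in> sets (G n)"
    by (auto simp: B_def filtration.space_F[OF G, of n, symmetric])
  then have AB_M[measurable]: "A \<in> sets M" "B \<in> sets M"
    using sub[of n] by (auto simp: subalgebra_def)
  have AB: "A \<union> B = space M" "A \<inter> B = {}" by (auto simp: A_def B_def)
  have V_A: "V (Suc n) \<omega> = V n \<omega>" if "\<omega> \<in> A" for \<omega>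
    using that by (cases "drop_time S k \<omega>") (auto simp: A_def V_def min_def)
  have V_B: "V n \<omega> = S n \<omega>" "V (Suc n) \<omega> = S (Suc n) \<omega>" if "\<omega> \<in> B" for \<omega>
    using that by (cases "drop_time S k \<omega>"; auto simp: A_def B_def V_def min_def intro!: arg_cong[where f="\<lambda>n. S n \<omega>"])+
  have split: "(\<integral>\<^sup>+\<omega>. ennreal (f \<omega>) \<partial>M) =
      (\<integral>\<^sup>+\<omega>\<in>A. ennreal (f \<omega>) \<partial>M) + (\<integral>\<^sup>+\<omega>\<in>B. ennreal (f \<omega>) \<partial>M)"
    if [measurable]: "f \<in> borel_measurable M" for f
    unfolding B_def by (rule nn_integral_split_complement) measurable
  have V_Suc[measurable]: "V (Suc n) \<in> borel_measurable M"
  proof -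
    have "(\<lambda>\<omega>. if \<omega> \<in> A then V n \<omega> else S (Suc n) \<omega>) \<in> borel_measurable M" by measurable
    then show ?thesis
      by (rule measurable_cong[THEN iffD1, rotated]) (use V_A V_B AB in auto)
  qed
  have "(\<integral>\<^sup>+\<omega>. ennreal (V (Suc n) \<omega>) \<partial>M) =
      (\<integral>\<^sup>+\<omega>\<in>A. ennreal (V (Suc n) \<omega>) \<partial>M) + (\<integral>\<^sup>+\<omega>\<in>B. ennreal (V (Suc n) \<omega>) \<partial>M)"
    by (rule split[OF V_Suc])
  also have "(\<integral>\<^sup>+\<omega>\<in>A. ennreal (V (Suc n) \<omega>) \<partial>M) = (\<integral>\<^sup>+\<omega>\<in>A. ennreal (V n \<omega>) \<partial>M)"
    by (intro nn_integral_cong) (simp add: indicator_def V_A)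
  also have "(\<integral>\<^sup>+\<omega>\<in>B. ennreal (V (Suc n) \<omega>) \<partial>M) = (\<integral>\<^sup>+\<omega>\<in>B. ennreal (S (Suc n) \<omega>) \<partial>M)"
    by (intro nn_integral_cong) (simp add: indicator_def V_B)
  also have "\<dots> = (\<integral>\<^sup>+\<omega>\<in>B. ennreal (S n \<omega>) \<partial>M)"
    by (rule mart[OF AB_G(2)])
  also have "\<dots> = (\<integral>\<^sup>+\<omega>\<in>B. ennreal (V n \<omega>) \<partial>M)"
    by (intro nn_integral_cong) (simp add: indicator_def V_B)
  finally show ?case
    using Suc split[OF V_M] V_Suc by simp
qed

section \<open>The martingale sampled at hitting times, and its loss of expectation\<close>

locale hitting_sequence = continuous_process +
  fixes \<beta> \<gamma> :: "nat \<Rightarrow> real"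
  assumes local_martingale: "local_martingale M F X"
    and mono_levels: "mono \<beta>" and mono_horizons: "mono \<gamma>" and horizon_0: "\<gamma> 0 = 0"
    and levels_at_top: "filterlim \<beta> at_top sequentially"
    and horizons_at_top: "filterlim \<gamma> at_top sequentially"
begin

definition S :: "nat \<Rightarrow> 'a \<Rightarrow> real" where
  "S n \<omega> = X (hit X (\<beta> n) (\<gamma> n) \<omega>) \<omega>"

definition G :: "nat \<Rightarrow> 'a measure" where
  "G n = pre_sigma (hit X (\<beta> n) (\<gamma> n))"

lemma horizon_nonneg: "0 \<le> \<gamma> n"
  using monoD[OF mono_horizons, of 0 n] horizon_0 by simp

lemmas stopping_time = stopping_time_hit[OF horizon_nonneg]

lemma S_0: "S 0 = X 0"
  by (rule ext) (simp add: S_def horizon_0 hit_zero)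

lemma S_pos: "\<omega> \<in> space M \<Longrightarrow> 0 < S n \<omega>"
  unfolding S_def by (intro pos hit_nonneg)

lemma hit_times_mono:
  assumes "m \<le> n" "\<omega> \<in> space M"
  shows "hit X (\<beta> m) (\<gamma> m) \<omega> \<le> hit X (\<beta> n) (\<gamma> n) \<omega>"
  using hit_mono[of X \<omega> "\<gamma> m" "\<gamma> n" "\<beta> m" "\<beta> n", OF continuous[OF assms(2)] horizon_nonneg]
    monoD[OF mono_levels assms(1)] monoD[OF mono_horizons assms(1)] by simp

lemma filtration_G: "filtration (space M) G"
proof
  show "space (G n) = space M" for n
    by (simp add: G_def space_pre_sigma)
  show "sets (G m) \<le> sets (G n)" if "m \<le> n" for m n
    unfolding G_def by (rule mono_pre_sigma[OF stopping_time stopping_time hit_times_mono[OF that]])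
qed

lemma subalgebra_G: "subalgebra M (G n)"
  unfolding G_def by (rule subalgebra_pre_sigma[OF stopping_time])

lemma S_adapted: "S n \<in> borel_measurable (G n)"
  unfolding S_def G_def by (rule measurable_at_stopping_time[OF stopping_time hit_nonneg])

lemma S_measurable: "S n \<in> borel_measurable M"
  by (rule measurable_from_subalg[OF subalgebra_G S_adapted])

lemma set_nn_integral_S:
  assumes "m \<le> n" "A \<in> sets (G m)"
  shows "(\<integral>\<^sup>+\<omega>\<in>A. ennreal (S n \<omega>) \<partial>M) = (\<integral>\<^sup>+\<omega>\<in>A. ennreal (S m \<omega>) \<partial>M)"
  unfolding S_def
  by (rule set_nn_integral_hit_eq[OF local_martingale horizon_nonneg monoD[OF mono_horizons assms(1)]
        monoD[OF mono_levels assms(1)], symmetric])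
     (use assms(2) in \<open>simp add: G_def\<close>)

text \<open>Comparison over the whole space with horizon 0, for which the hitting time is 0.\<close>

lemma nn_integral_hit:
  assumes "0 \<le> c"
  shows "(\<integral>\<^sup>+\<omega>. ennreal (X (hit X b c \<omega>) \<omega>) \<partial>M) = (\<integral>\<^sup>+\<omega>. ennreal (X 0 \<omega>) \<partial>M)"
proof -
  have "space M \<in> sets (pre_sigma (hit X b 0))"
    using sets.top[of "pre_sigma (hit X b 0)"] by (simp add: space_pre_sigma)
  from set_nn_integral_hit_eq[OF local_martingale order_refl assms order_refl this]
  have "(\<integral>\<^sup>+\<omega>\<in>space M. ennreal (X 0 \<omega>) \<partial>M) = (\<integral>\<^sup>+\<omega>\<in>space M. ennreal (X (hit X b c \<omega>) \<omega>) \<partial>M)"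
    by (simp add: hit_zero)
  moreover have "(\<integral>\<^sup>+\<omega>\<in>space M. f \<omega> \<partial>M) = (\<integral>\<^sup>+\<omega>. f \<omega> \<partial>M)" for f :: "'a \<Rightarrow> ennreal"
    by (intro nn_integral_cong) simp
  ultimately show ?thesis by simp
qed

lemma integrable_X_0: "integrable M (X 0)"
  by (rule local_martingale_integrable[OF local_martingale order_refl])

lemma nn_integral_X_0: "(\<integral>\<^sup>+\<omega>. ennreal (X 0 \<omega>) \<partial>M) = ennreal (\<integral>\<omega>. X 0 \<omega> \<partial>M)"
  using pos[of 0] by (intro nn_integral_eq_integral integrable_X_0) (auto intro!: AE_I2 simp: less_imp_le)

lemma nn_integral_S: "(\<integral>\<^sup>+\<omega>. ennreal (S n \<omega>) \<partial>M) = (\<integral>\<^sup>+\<omega>. ennreal (X 0 \<omega>) \<partial>M)"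
  unfolding S_def by (rule nn_integral_hit[OF horizon_nonneg])

lemma martingale_S: "martingale M UNIV G S"
proof (subst martingale_iff_set_nn_integral)
  show "integrable M (S n)" for n
    by (rule integrableI_nonneg[OF S_measurable])
       (use S_pos in \<open>auto simp: less_imp_le nn_integral_S nn_integral_X_0 intro!: AE_I2\<close>)
qed (use S_pos set_nn_integral_S in \<open>auto simp: filtration_G subalgebra_G S_adapted less_imp_le\<close>)

text \<open>Fatou's lemma with the constant finite expectation of \<open>X 0\<close>. Together with
  eventual monotonicity this yields convergence where the drop time is infinite.\<close>

lemma AE_liminf_finite: "AE \<omega> in M. liminf (\<lambda>n. ennreal (S n \<omega>)) < \<infinity>"
proof -
  have [measurable]: "S n \<in> borel_measurable M" for n by (rule S_measurable)
  have "(\<integral>\<^sup>+\<omega>. liminf (\<lambda>n. ennreal (S n \<omega>)) \<partial>M) \<le> liminf (\<lambda>n. \<integral>\<^sup>+\<omega>. ennreal (S n \<omega>) \<partial>M)"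
    by (rule nn_integral_liminf) measurable
  also have "\<dots> < \<infinity>"
    by (simp add: nn_integral_S nn_integral_X_0 Liminf_const)
  finally have "AE \<omega> in M. liminf (\<lambda>n. ennreal (S n \<omega>)) \<noteq> \<infinity>"
    by (intro nn_integral_PInf_AE) auto
  then show ?thesis
    by eventually_elim (simp add: less_top)
qed

text \<open>If the level \<open>\<beta> n\<close> is reached by time \<open>T\<close>, then for every \<open>j \<le> n\<close> with \<open>T < \<gamma> j\<close> the level
  \<open>\<beta> j\<close> is hit at the \<open>j\<close>-th stopping time, so \<open>S\<close> cannot drop at \<open>j\<close>; hence all drops up to
  \<open>n\<close> have indices below \<open>N\<close>.\<close>

lemma less_drop_time:
  assumes \<omega>: "\<omega> \<in> space M" and N: "1 \<le> N" "\<And>j. N \<le> j \<Longrightarrow> T < \<gamma> j"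
    and reach: "s \<in> {0..T}" "\<beta> n \<le> X s \<omega>"
  shows "enat n < drop_time S N \<omega>"
proof (rule ccontr)
  assume "\<not> ?thesis"
  then obtain i where i: "drop_time S N \<omega> = enat i" "i \<le> n"
    by (cases "drop_time S N \<omega>") auto
  \<comment> \<open>Since \<open>N\<close> is positive, its finite drop time is a genuine drop and
    not the initial value 0.\<close>
  have "S i \<omega> < S (i - 1) \<omega>"
    using drop_time_Suc_eq_enat[of S "N - 1" \<omega> i] N(1) i(1) by simp
  moreover have "N \<le> i"
    using le_drop_time[of N S \<omega>] i(1) by simp
  then have "T < \<gamma> i" by (rule N(2))
  have "\<beta> i \<le> X s \<omega>"
    using monoD[OF mono_levels i(2)] reach(2) by simp
  then have "hit X (\<beta> i) (\<gamma> i) \<omega> \<le> s"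
    using less_hit[of s X "\<beta> i" "\<gamma> i" \<omega>] reach(1) by fastforce
  then have "hit X (\<beta> i) (\<gamma> i) \<omega> < \<gamma> i"
    using \<open>T < \<gamma> i\<close> reach(1) by simp
  then have level: "\<beta> i \<le> S i \<omega>"
    unfolding S_def by (rule hit_less_bound[of X \<omega>, OF continuous[OF \<omega>] horizon_nonneg])
  \<comment> \<open>If the two hitting times differ, the earlier one precedes the
    \<open>i\<close>-th, so the path there is still below the level \<open>\<beta> i\<close> that
    \<open>S i\<close> has attained.\<close>
  have "S (i - 1) \<omega> \<le> S i \<omega>"
  proof (cases "hit X (\<beta> (i - 1)) (\<gamma> (i - 1)) \<omega> = hit X (\<beta> i) (\<gamma> i) \<omega>")
    case False
    then have "hit X (\<beta> (i - 1)) (\<gamma> (i - 1)) \<omega> < hit X (\<beta> i) (\<gamma> i) \<omega>"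
      using hit_times_mono[of "i - 1" i, OF _ \<omega>] by simp
    from less_hit[OF hit_nonneg this] level show ?thesis
      unfolding S_def by simp
  qed (simp add: S_def)
  ultimately show False by simp
qed

text \<open>A continuous path is bounded on the compact interval \<open>{0..T}\<close>, whereas the
  levels diverge.\<close>

lemma level_not_reached_eventually:
  assumes \<omega>: "\<omega> \<in> space M"
  shows "\<forall>\<^sub>F n in sequentially. \<forall>s\<in>{0..T}. X s \<omega> < \<beta> n"
proof -
  have "compact ((\<lambda>t. X t \<omega>) ` {0..T})"
    by (intro compact_continuous_image continuous_on_subset[OF continuous[OF \<omega>]]) auto
  then have "bdd_above ((\<lambda>t. X t \<omega>) ` {0..T})"
    by (intro bounded_imp_bdd_above compact_imp_bounded)
  then obtain K where K: "\<And>s. s \<in> {0..T} \<Longrightarrow> X s \<omega> \<le> K"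
    unfolding bdd_above_def by blast
  have "\<forall>\<^sub>F n in sequentially. K < \<beta> n"
    using levels_at_top by (simp add: filterlim_at_top_dense)
  then show ?thesis
    by eventually_elim (use K in fastforce)
qed

text \<open>\<open>V\<close> and the process sampled at the hitting time with horizon
  \<open>T\<close> have the same expectation and agree on \<open>D\<close>. Off \<open>D\<close> the
  latter is \<open>X T\<close>, so cancelling the finite integral over \<open>D\<close> gives the
  bound.\<close>

lemma nn_integral_not_reached_le:
  assumes T: "0 \<le> T" and N: "1 \<le> N" "\<And>j. N \<le> j \<Longrightarrow> T < \<gamma> j" and n: "N \<le> n"
  defines "D \<equiv> {\<omega> \<in> space M. \<exists>s\<in>{0..T}. \<beta> n \<le> X s \<omega>}"
    and "V \<equiv> \<lambda>\<omega>. S (the_enat (min (drop_time S N \<omega>) (enat n))) \<omega>"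
  shows "D \<in> sets M" and "V \<in> borel_measurable M"
    and "(\<integral>\<^sup>+\<omega>\<in>space M - D. ennreal (V \<omega>) \<partial>M) \<le> (\<integral>\<^sup>+\<omega>. ennreal (X T \<omega>) \<partial>M)"
proof -
  have "D \<in> sets (F T)"
    using path_exceeds_measurable[OF T, of "\<beta> n"] by (simp add: D_def pred_def space_F)
  then show D[measurable]: "D \<in> sets M" by (rule sets_F_M)
  let ?h = "hit X (\<beta> n) T"
  have V: "V \<in> borel_measurable M \<and> (\<integral>\<^sup>+\<omega>. ennreal (V \<omega>) \<partial>M) = (\<integral>\<^sup>+\<omega>. ennreal (S 0 \<omega>) \<partial>M)"
    unfolding V_def
    by (rule nn_integral_stopped_at_drop_time[where G=G])
       (auto simp: filtration_G subalgebra_G S_adapted intro: set_nn_integral_S)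
  then show V_M[measurable]: "V \<in> borel_measurable M" ..
  have h_M[measurable]: "(\<lambda>\<omega>. X (?h \<omega>) \<omega>) \<in> borel_measurable M"
    by (rule measurable_from_subalg[OF subalgebra_pre_sigma measurable_at_stopping_time])
       (auto intro: stopping_time_hit T hit_nonneg)
  \<comment> \<open>On \<open>D\<close> the level is reached by \<open>T\<close>, before the horizon
    \<open>\<gamma> n\<close>, since \<open>N \<le> n\<close>. The \<open>N\<close>-th drop comes
    after \<open>n\<close>, so \<open>V\<close> is \<open>S n\<close> there.\<close>
  have D': "hit X (\<beta> n) (\<gamma> n) \<omega> = ?h \<omega>" "enat n < drop_time S N \<omega>" if "\<omega> \<in> D" for \<omega>
  proof -
    from that obtain s where \<omega>: "\<omega> \<in> space M" and s: "s \<in> {0..T}" "\<beta> n \<le> X s \<omega>"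
      by (auto simp: D_def)
    have "hit X (\<beta> n) (\<gamma> n) \<omega> \<le> s"
      using less_hit[of s X "\<beta> n" "\<gamma> n" \<omega>] s by fastforce
    with s have "hit X (\<beta> n) (\<gamma> n) \<omega> \<le> T" by simp
    then show "hit X (\<beta> n) (\<gamma> n) \<omega> = ?h \<omega>"
      using hit_eq_hit[of X \<omega> T "\<gamma> n" "\<beta> n", OF continuous[OF \<omega>] T] N(2)[OF n] by simp
    show "enat n < drop_time S N \<omega>"
      by (rule less_drop_time[OF \<omega> N s])
  qed
  have V_D: "V \<omega> = X (?h \<omega>) \<omega>" if "\<omega> \<in> D" for \<omega>
    using D'[OF that] by (simp add: V_def S_def min_absorb2 less_imp_le)
  have h_T: "?h \<omega> = T" if "\<omega> \<in> space M - D" for \<omega>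
  proof (rule ccontr)
    assume "?h \<omega> \<noteq> T"
    then have "?h \<omega> < T" using hit_le[OF T, of X "\<beta> n" \<omega>] by simp
    then have "\<beta> n \<le> X (?h \<omega>) \<omega>"
      using hit_less_bound[of X \<omega> T "\<beta> n", OF continuous T] that by simp
    with that \<open>?h \<omega> < T\<close> hit_nonneg[of X "\<beta> n" T \<omega>] show False
      by (auto simp: D_def)
  qed
  have split: "(\<integral>\<^sup>+\<omega>. ennreal (f \<omega>) \<partial>M) =
      (\<integral>\<^sup>+\<omega>\<in>D. ennreal (f \<omega>) \<partial>M) + (\<integral>\<^sup>+\<omega>\<in>space M - D. ennreal (f \<omega>) \<partial>M)"
    if [measurable]: "f \<in> borel_measurable M" for f
    by (rule nn_integral_split_complement) measurable
  have total: "(\<integral>\<^sup>+\<omega>. ennreal (V \<omega>) \<partial>M) = (\<integral>\<^sup>+\<omega>. ennreal (X (?h \<omega>) \<omega>) \<partial>M)"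
    using V nn_integral_hit[OF T, of "\<beta> n"] by (simp add: S_0)
  have on_D: "(\<integral>\<^sup>+\<omega>\<in>D. ennreal (V \<omega>) \<partial>M) = (\<integral>\<^sup>+\<omega>\<in>D. ennreal (X (?h \<omega>) \<omega>) \<partial>M)"
    by (intro nn_integral_cong) (simp add: indicator_def V_D)
  have "(\<integral>\<^sup>+\<omega>\<in>D. ennreal (X (?h \<omega>) \<omega>) \<partial>M) \<le> (\<integral>\<^sup>+\<omega>. ennreal (X (?h \<omega>) \<omega>) \<partial>M)"
    by (intro nn_integral_mono) (simp add: indicator_def)
  also have "\<dots> < \<infinity>"
    by (simp add: nn_integral_hit[OF T] nn_integral_X_0)
  finally have "(\<integral>\<^sup>+\<omega>\<in>D. ennreal (X (?h \<omega>) \<omega>) \<partial>M) \<noteq> \<infinity>" by simp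
  then have "(\<integral>\<^sup>+\<omega>\<in>space M - D. ennreal (V \<omega>) \<partial>M) =
      (\<integral>\<^sup>+\<omega>\<in>space M - D. ennreal (X (?h \<omega>) \<omega>) \<partial>M)"
    using total unfolding split[OF V_M] split[OF h_M] on_D by (simp add: ennreal_add_left_cancel)
  also have "\<dots> = (\<integral>\<^sup>+\<omega>\<in>space M - D. ennreal (X T \<omega>) \<partial>M)"
    by (intro nn_integral_cong) (simp add: indicator_def h_T)
  also have "\<dots> \<le> (\<integral>\<^sup>+\<omega>. ennreal (X T \<omega>) \<partial>M)"
    by (intro nn_integral_mono) (simp add: indicator_def)
  finally show "(\<integral>\<^sup>+\<omega>\<in>space M - D. ennreal (V \<omega>) \<partial>M) \<le> (\<integral>\<^sup>+\<omega>. ennreal (X T \<omega>) \<partial>M)" .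
qed

text \<open>If the drop time is finite, the stopped sequence is eventually constant; otherwise it is
  \<open>S\<close> itself, eventually nondecreasing with finite liminf. The indicator is eventually
  1, since large levels are not reached by \<open>T\<close>.\<close>

lemma AE_not_reached_tendsto_sampled_value:
  "AE \<omega> in M. (\<lambda>n. S (the_enat (min (drop_time S k \<omega>) (enat n))) \<omega> *
      indicator (space M - {\<omega> \<in> space M. \<exists>s\<in>{0..T}. \<beta> n \<le> X s \<omega>}) \<omega>)
    \<longlonglongrightarrow> sampled_value S (drop_time S k) \<omega>"
  using AE_liminf_finite AE_space
proof eventually_elim
  fix \<omega> assume fin: "liminf (\<lambda>n. ennreal (S n \<omega>)) < \<infinity>" and \<omega>: "\<omega> \<in> space M"
  let ?V = "\<lambda>n. S (the_enat (min (drop_time S k \<omega>) (enat n))) \<omega>"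
  have lim: "?V \<longlonglongrightarrow> sampled_value S (drop_time S k) \<omega>"
  proof (cases "drop_time S k \<omega>")
    case (enat i)
    have "\<forall>\<^sub>F n in sequentially. ?V n = S i \<omega>"
      using eventually_ge_at_top[of i] by eventually_elim (simp add: enat min_absorb1)
    then show ?thesis
      by (simp add: tendsto_eventually sampled_value_def enat)
  next
    case infinity
    from drop_time_infinity_mono[OF this] obtain N where "\<And>n. N \<le> n \<Longrightarrow> S n \<omega> \<le> S (Suc n) \<omega>"
      by blast
    from LIMSEQ_of_eventually_mono[of N "\<lambda>n. S n \<omega>", OF this fin] show ?thesis
      by (simp add: sampled_value_def infinity)
  qed
  have "\<forall>\<^sub>F n in sequentially. ?V n *
      indicator (space M - {\<omega> \<in> space M. \<exists>s\<in>{0..T}. \<beta> n \<le> X s \<omega>}) \<omega> = ?V n"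
    using level_not_reached_eventually[OF \<omega>, of T]
    by eventually_elim (use \<omega> in \<open>auto simp: indicator_def not_less[symmetric]\<close>)
  then show "(\<lambda>n. ?V n * indicator (space M - {\<omega> \<in> space M. \<exists>s\<in>{0..T}. \<beta> n \<le> X s \<omega>}) \<omega>)
      \<longlonglongrightarrow> sampled_value S (drop_time S k) \<omega>"
    by (rule tendsto_cong[THEN iffD2]) (rule lim)
qed

lemma bubble:
  assumes "\<not> martingale M {0..} F X"
  shows "bubble_measure M G S"
proof -
  have "strict_local_martingale M F X"
    using assms local_martingale by (simp add: strict_local_martingale_def)
  from strict_local_martingale_expectation_drop[OF this] obtain T where T: "0 \<le> T"
      and less: "(\<integral>\<^sup>+\<omega>. ennreal (X T \<omega>) \<partial>M) < (\<integral>\<^sup>+\<omega>. ennreal (X 0 \<omega>) \<partial>M)"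
    by blast
  have "\<forall>\<^sub>F n in sequentially. T < \<gamma> n"
    using horizons_at_top by (simp add: filterlim_at_top_dense)
  then obtain N0 where "\<And>j. N0 \<le> j \<Longrightarrow> T < \<gamma> j"
    by (auto simp: eventually_sequentially)
  \<comment> \<open>Enlarged to at least 1, because a bubble asks for a positive drop index.\<close>
  then obtain N where N: "1 \<le> N" "\<And>j. N \<le> j \<Longrightarrow> T < \<gamma> j"
    by (metis max.cobounded1 max.cobounded2 order_trans)
  define Z where "Z = sampled_value S (drop_time S N)"
  define V where "V n \<omega> = S (the_enat (min (drop_time S N \<omega>) (enat n))) \<omega>" for n \<omega>
  define E where "E n = space M - {\<omega> \<in> space M. \<exists>s\<in>{0..T}. \<beta> n \<le> X s \<omega>}" for n
  have lim: "AE \<omega> in M. (\<lambda>n. V n \<omega> * indicator (E n) \<omega>) \<longlonglongrightarrow> Z \<omega>"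
    unfolding V_def E_def Z_def by (rule AE_not_reached_tendsto_sampled_value)
  have nn: "(\<integral>\<^sup>+\<omega>. ennreal (Z \<omega>) \<partial>M) \<le> (\<integral>\<^sup>+\<omega>. ennreal (X T \<omega>) \<partial>M)"
  proof (rule nn_integral_le_of_tendsto)
    \<comment> \<open>The shift by \<open>N\<close> is there because the bound on the integrals is
      available for \<open>N \<le> n\<close>.\<close>
    show "AE \<omega> in M. (\<lambda>n. V (n + N) \<omega> * indicator (E (n + N)) \<omega>) \<longlonglongrightarrow> Z \<omega>"
      using lim by eventually_elim (rule LIMSEQ_ignore_initial_segment)
    fix n
    note not_reached = nn_integral_not_reached_le[where n="n + N", OF T N le_add2]
    have [measurable]: "V (n + N) \<in> borel_measurable M" "E (n + N) \<in> sets M"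
      unfolding V_def E_def using not_reached(1,2) by (auto intro: sets.compl_sets)
    show "(\<lambda>\<omega>. V (n + N) \<omega> * indicator (E (n + N)) \<omega>) \<in> borel_measurable M"
      by measurable
    have "(\<integral>\<^sup>+\<omega>. ennreal (V (n + N) \<omega> * indicator (E (n + N)) \<omega>) \<partial>M) =
        (\<integral>\<^sup>+\<omega>\<in>E (n + N). ennreal (V (n + N) \<omega>) \<partial>M)"
      by (intro nn_integral_cong) (simp add: indicator_def)
    also have "\<dots> \<le> (\<integral>\<^sup>+\<omega>. ennreal (X T \<omega>) \<partial>M)"
      unfolding V_def E_def by (rule not_reached(3))
    finally show "(\<integral>\<^sup>+\<omega>. ennreal (V (n + N) \<omega> * indicator (E (n + N)) \<omega>) \<partial>M) \<le>
        (\<integral>\<^sup>+\<omega>. ennreal (X T \<omega>) \<partial>M)" .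
  qed
  have Z_nonneg: "AE \<omega> in M. 0 \<le> Z \<omega>"
    using lim AE_space
  proof eventually_elim
    fix \<omega> assume "(\<lambda>n. V n \<omega> * indicator (E n) \<omega>) \<longlonglongrightarrow> Z \<omega>" and "\<omega> \<in> space M"
    then show "0 \<le> Z \<omega>"
      by (intro LIMSEQ_le_const) (auto simp: V_def less_imp_le[OF S_pos])
  qed
  have "(\<integral>\<omega>. Z \<omega> \<partial>M) < (\<integral>\<omega>. S 0 \<omega> \<partial>M)"
  proof (cases "integrable M Z")
    case True
    have "ennreal (\<integral>\<omega>. Z \<omega> \<partial>M) < ennreal (\<integral>\<omega>. X 0 \<omega> \<partial>M)"
      using nn less by (simp add: nn_integral_eq_integral[OF True Z_nonneg] nn_integral_X_0)
    then show ?thesis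
      by (simp add: S_0 ennreal_less_iff integral_nonneg_AE[OF Z_nonneg])
  next
    \<comment> \<open>The Bochner integral of \<open>Z\<close> is then 0 by convention, and the
      expectation of \<open>X 0\<close> is positive because it strictly exceeds an element of
      \<open>ennreal\<close>.\<close>
    case False
    then show ?thesis
      using less by (simp add: not_integrable_integral_eq S_0 nn_integral_X_0)
        (metis ennreal_neg not_less not_less_zero)
  qed
  then show ?thesis
    unfolding bubble_measure_def Z_def
    using prob_space_axioms martingale_S S_pos N(1) by (auto simp: less_imp_le)
qed

end

section \<open>Reduction of the given sequences to levels and horizons from index 0\<close>

theorem proposition4p1:
  fixes M :: "'a measure" and F :: "real \<Rightarrow> 'a measure" and X :: "real \<Rightarrow> 'a \<Rightarrow> real"
    and a b :: "nat \<Rightarrow> real"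
  assumes "prob_space M"
    and "filtration (space M) F"
    and "\<And>t. subalgebra M (F t)"
    and "strict_local_martingale M F X"
    and "\<And>\<omega>. \<omega> \<in> space M \<Longrightarrow> continuous_on {0..} (\<lambda>t. X t \<omega>)"
    and "\<And>t \<omega>. 0 \<le> t \<Longrightarrow> \<omega> \<in> space M \<Longrightarrow> 0 < X t \<omega>"
    and "\<And>n. 1 \<le> n \<Longrightarrow> 0 < a n" and "mono_on {1..} a" and "filterlim a at_top sequentially"
    and "\<And>n. 1 \<le> n \<Longrightarrow> 0 < b n" and "mono_on {1..} b" and "filterlim b at_top sequentially"
  shows "bubble_measure M (\<lambda>n. filtration.pre_sigma (space M) F (tau_ab X a b n)) (S_ab X a b)"
proof -
  interpret prob_space M by fact
  interpret filtration "space M" F by fact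
  have strict: "local_martingale M F X" "\<not> martingale M {0..} F X"
    using assms(4) by (auto simp: strict_local_martingale_def)
  interpret continuous_process M F X
    by unfold_locales (use assms(3,5,6) strict(1) in \<open>auto simp: local_martingale_def\<close>)
  define \<beta> where "\<beta> n = b (max 1 n)" for n
  define \<gamma> where "\<gamma> n = (if n = 0 then 0 else a n)" for n
  interpret hitting_sequence M F X \<beta> \<gamma>
  proof
    show "mono \<beta>"
      using mono_onD[OF assms(11)] by (intro monoI) (simp add: \<beta>_def)
    show "mono \<gamma>"
    proof (rule monoI)
      fix m n :: nat assume "m \<le> n"
      \<comment> \<open>From index 0 to a positive index the inequality is the positivity of
        \<open>a\<close>.\<close>
      then show "\<gamma> m \<le> \<gamma> n"
        using mono_onD[OF assms(8), of m n] assms(7)[of n] by (auto simp: \<gamma>_def less_imp_le)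
    qed
    have "\<forall>\<^sub>F n in sequentially. \<beta> n = b n" "\<forall>\<^sub>F n in sequentially. \<gamma> n = a n"
      using eventually_ge_at_top[of 1] by (eventually_elim; simp add: \<beta>_def \<gamma>_def)+
    then show "filterlim \<beta> at_top sequentially" "filterlim \<gamma> at_top sequentially"
      using assms(9,12) by (simp_all cong: filterlim_cong)
  qed (simp_all add: strict \<gamma>_def)
  have tau: "tau_ab X a b n = hit X (\<beta> n) (\<gamma> n)" for n
    by (simp add: tau_ab_eq_hit \<beta>_def \<gamma>_def)
  have "(\<lambda>n. pre_sigma (tau_ab X a b n)) = G" "S_ab X a b = S"
    by (intro ext; simp add: G_def S_def S_ab_def tau)+
  with bubble[OF strict(2)] show ?thesis by simp
qed

end
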